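(* Let $\mathcal{V}_M$ be the ordered Mostowski model and let $\mathfrak{m}$ denote the cardinality of its set of atoms. Then the following holds in $\mathcal{V}_M$: $$\mathfrak{m} < \operatorname{fin}(\mathfrak{m}) < 2^{\mathfrak{m}} < \operatorname{seq}^{1\text{-}1}(\mathfrak{m}) < \operatorname{seq}(\mathfrak{m}).$$
   Context: Permutation models: work in a model of ZFA + AC (set theory with atoms) with set of atoms $A$, and let $\mathcal{G}$ be a group of permutations of $A$; each $\pi\in\mathcal{G}$ extends uniquely to an $\in$-automorphism of the universe, also written $\pi$. For $E\subseteq A$ let $\operatorname{fix}_{\mathcal{G}}(E)=\{\pi\in\mathcal{G}:\pi a=a\text{ for all }a\in E\}$ and for an object $x$ let $\operatorname{sym}_{\mathcal{G}}(x)=\{\pi\in\mathcal{G}:\pi x=x\}$. With the normal ideal $I_{\mathrm{fin}}$ of finite subsets of $A$, an object $x$ is symmetric if there is a finite $E\subseteq A$ (a support of $x$) with $\operatorname{fix}_{\mathcal{G}}(E)\subseteq\operatorname{sym}_{\mathcal{G}}(x)$. The permutation model is the class of all hereditarily symmetric objects; it is a transitive model of ZFA. The ordered Mostowski model $\mathcal{V}_M$ is the permutation model obtained when $A$ is countably infinite and equipped with a dense linear order $<^M$ without smallest or greatest element, $\mathcal{G}$ is the group of all order-preserving permutations of $A$, and the ideal is $I_{\mathrm{fin}}$. Cardinal relations in $\mathcal{V}_M$ are computed using functions belonging to $\mathcal{V}_M$: $\mathfrak{p}\le\mathfrak{q}$ iff there is in the model an injection from a set of cardinality $\mathfrak{p}$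 into a set of cardinality $\mathfrak{q}$; $\mathfrak{p}<\mathfrak{q}$ means $\mathfrak{p}\le\mathfrak{q}$ and $\mathfrak{p}\neq\mathfrak{q}$. For a set $m$ of cardinality $\mathfrak{m}$ (all computed in the model): $\operatorname{fin}(\mathfrak{m})$ is the cardinality of the set of finite subsets of $m$; $\operatorname{seq}^{1\text{-}1}(\mathfrak{m})$ that of the set of finite sequences of elements of $m$ without repetition; $\operatorname{seq}(\mathfrak{m})$ that of the set of all finite sequences of elements of $m$; $2^{\mathfrak{m}}$ that of the power set of $m$. *)

theory Defs
  imports "HOL-Library.Countable_Set" "HOL-Combinatorics.Permutations"
begin

section \<open>ZFA with choice\<close>

text \<open>
  A type of this class is the universe of sets and atoms. Classes are HOL predicates and class functions
  are HOL functions, so Separation and Replacement are single axioms instead of schemes.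
\<close>

class zfa_choice =
  fixes mem :: "'a \<Rightarrow> 'a \<Rightarrow> bool"  (infix "\<in>\<^sub>v" 50)
    and is_atom :: "'a \<Rightarrow> bool"
  assumes ax_atom_no_element: "is_atom a \<Longrightarrow> \<not> x \<in>\<^sub>v a"
    and ax_set_of_atoms: "\<exists>s. \<not> is_atom s \<and> (\<forall>x. x \<in>\<^sub>v s \<longleftrightarrow> is_atom x)"
    and ax_extensionality:
      "\<not> is_atom x \<Longrightarrow> \<not> is_atom y \<Longrightarrow> (\<forall>z. z \<in>\<^sub>v x \<longleftrightarrow> z \<in>\<^sub>v y) \<Longrightarrow> x = y"
    and ax_foundation: "(\<exists>y. y \<in>\<^sub>v x) \<Longrightarrow> \<exists>y. y \<in>\<^sub>v x \<and> (\<forall>z. z \<in>\<^sub>v y \<longrightarrow> \<not> z \<in>\<^sub>v x)"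
    and ax_empty_set: "\<exists>s. \<not> is_atom s \<and> (\<forall>z. \<not> z \<in>\<^sub>v s)"
    and ax_pairing: "\<exists>s. \<not> is_atom s \<and> (\<forall>z. z \<in>\<^sub>v s \<longleftrightarrow> z = x \<or> z = y)"
    and ax_union: "\<exists>s. \<not> is_atom s \<and> (\<forall>z. z \<in>\<^sub>v s \<longleftrightarrow> (\<exists>y. y \<in>\<^sub>v x \<and> z \<in>\<^sub>v y))"
    and ax_power_set:
      "\<exists>s. \<not> is_atom s \<and> (\<forall>y. y \<in>\<^sub>v s \<longleftrightarrow> \<not> is_atom y \<and> (\<forall>z. z \<in>\<^sub>v y \<longrightarrow> z \<in>\<^sub>v x))"
    and ax_infinity:
      "\<exists>w. (\<exists>e. e \<in>\<^sub>v w \<and> \<not> is_atom e \<and> (\<forall>z. \<not> z \<in>\<^sub>v e)) \<and>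
           (\<forall>x. x \<in>\<^sub>v w \<longrightarrow> (\<exists>y. y \<in>\<^sub>v w \<and> (\<forall>z. z \<in>\<^sub>v y \<longleftrightarrow> z \<in>\<^sub>v x \<or> z = x)))"
    and ax_separation: "\<exists>s. \<not> is_atom s \<and> (\<forall>z. z \<in>\<^sub>v s \<longleftrightarrow> z \<in>\<^sub>v x \<and> P z)"
    and ax_replacement: "\<exists>s. \<not> is_atom s \<and> (\<forall>z. z \<in>\<^sub>v s \<longleftrightarrow> (\<exists>y. y \<in>\<^sub>v x \<and> z = F y))"
    and ax_choice:
      "(\<forall>y. y \<in>\<^sub>v x \<longrightarrow> (\<exists>z. z \<in>\<^sub>v y)) \<Longrightarrow>
       (\<forall>y y' z. y \<in>\<^sub>v x \<longrightarrow> y' \<in>\<^sub>v x \<longrightarrow> z \<in>\<^sub>v y \<longrightarrow> z \<in>\<^sub>v y' \<longrightarrow> y = y') \<Longrightarrow>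
       \<exists>c. \<forall>y. y \<in>\<^sub>v x \<longrightarrow> (\<exists>!z. z \<in>\<^sub>v y \<and> z \<in>\<^sub>v c)"

definition elts :: "'v::zfa_choice \<Rightarrow> 'v set"
  where "elts x = {y. y \<in>\<^sub>v x}"

definition atoms :: "'v::zfa_choice set"
  where "atoms = {a. is_atom a}"

text \<open>The set with the given extension; unspecified if the extension is a proper class.\<close>

definition vset :: "'v::zfa_choice set \<Rightarrow> 'v"
  where "vset X = (THE s. \<not> is_atom s \<and> elts s = X)"


section \<open>Permutation models for the ideal of finite sets of atoms\<close>

definition mem_automorphism :: "('v::zfa_choice \<Rightarrow> 'v) \<Rightarrow> bool"
  where "mem_automorphism \<phi> \<longleftrightarrow> bij \<phi> \<and> (\<forall>x. is_atom (\<phi> x) \<longleftrightarrow> is_atom x) \<and>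
           (\<forall>x y. \<phi> x \<in>\<^sub>v \<phi> y \<longleftrightarrow> x \<in>\<^sub>v y)"

text \<open>
  The automorphism of the universe induced by a permutation of the atoms; by \<open>\<in>\<close>-induction it exists
  and is unique.  Permutations of the atoms are given as functions that are the identity
  elsewhere.
\<close>

definition extend :: "('v::zfa_choice \<Rightarrow> 'v) \<Rightarrow> 'v \<Rightarrow> 'v"
  where "extend \<pi> = (THE \<phi>. mem_automorphism \<phi> \<and> (\<forall>a\<in>atoms. \<phi> a = \<pi> a))"

definition fix_group :: "('v::zfa_choice \<Rightarrow> 'v) set \<Rightarrow> 'v set \<Rightarrow> ('v \<Rightarrow> 'v) set"
  where "fix_group G E = {\<pi> \<in> G. \<forall>a\<in>E. \<pi> a = a}"

definition sym_group :: "('v::zfa_choice \<Rightarrow> 'v) set \<Rightarrow> 'v \<Rightarrow> ('v \<Rightarrow> 'v) set"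
  where "sym_group G x = {\<pi> \<in> G. extend \<pi> x = x}"

definition symmetric :: "('v::zfa_choice \<Rightarrow> 'v) set \<Rightarrow> 'v \<Rightarrow> bool"
  where "symmetric G x \<longleftrightarrow> (\<exists>E. E \<subseteq> atoms \<and> finite E \<and> fix_group G E \<subseteq> sym_group G x)"

inductive_set permutation_model :: "('v::zfa_choice \<Rightarrow> 'v) set \<Rightarrow> 'v set"
  for G :: "('v \<Rightarrow> 'v) set"
  where "symmetric G x \<Longrightarrow> (\<And>y. y \<in>\<^sub>v x \<Longrightarrow> y \<in> permutation_model G) \<Longrightarrow> x \<in> permutation_model G"


section \<open>The ordered Mostowski model\<close>

definition dense_order_without_endpoints :: "'a set \<Rightarrow> ('a \<times> 'a) set \<Rightarrow> bool"
  where "dense_order_without_endpoints A R \<longleftrightarrow>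
           R \<subseteq> A \<times> A \<and> strict_linear_order_on A R \<and>
           (\<forall>x y. (x, y) \<in> R \<longrightarrow> (\<exists>z. (x, z) \<in> R \<and> (z, y) \<in> R)) \<and>
           (\<forall>x\<in>A. \<exists>y. (y, x) \<in> R) \<and> (\<forall>x\<in>A. \<exists>y. (x, y) \<in> R)"

definition order_automorphisms :: "'a set \<Rightarrow> ('a \<times> 'a) set \<Rightarrow> ('a \<Rightarrow> 'a) set"
  where "order_automorphisms A R =
           {\<pi>. \<pi> permutes A \<and> (\<forall>x\<in>A. \<forall>y\<in>A. (\<pi> x, \<pi> y) \<in> R \<longleftrightarrow> (x, y) \<in> R)}"

definition mostowski_model :: "('v::zfa_choice \<times> 'v) set \<Rightarrow> 'v set"
  where "mostowski_model R = permutation_model (order_automorphisms atoms R)"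


section \<open>Functions, cardinals and set constructions computed in a class\<close>

text \<open>Kuratowski pairs, functions as sets of pairs, and von Neumann natural numbers.\<close>

definition vpair :: "'v::zfa_choice \<Rightarrow> 'v \<Rightarrow> 'v"
  where "vpair x y = vset {vset {x}, vset {x, y}}"

definition vfunction :: "'v::zfa_choice \<Rightarrow> 'v \<Rightarrow> 'v \<Rightarrow> bool"
  where "vfunction f x y \<longleftrightarrow> \<not> is_atom f \<and>
           (\<forall>p\<in>elts f. \<exists>a\<in>elts x. \<exists>b\<in>elts y. p = vpair a b) \<and>
           (\<forall>a\<in>elts x. \<exists>!b. vpair a b \<in>\<^sub>v f)"

definition vinjection :: "'v::zfa_choice \<Rightarrow> 'v \<Rightarrow> 'v \<Rightarrow> bool"
  where "vinjection f x y \<longleftrightarrow> vfunction f x y \<and>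
           (\<forall>a a' b. vpair a b \<in>\<^sub>v f \<longrightarrow> vpair a' b \<in>\<^sub>v f \<longrightarrow> a = a')"

definition vbijection :: "'v::zfa_choice \<Rightarrow> 'v \<Rightarrow> 'v \<Rightarrow> bool"
  where "vbijection f x y \<longleftrightarrow> vinjection f x y \<and> (\<forall>b\<in>elts y. \<exists>a. vpair a b \<in>\<^sub>v f)"

primrec vnat :: "nat \<Rightarrow> 'v::zfa_choice"
  where
    "vnat 0 = vset {}"
  | "vnat (Suc n) = vset (insert (vnat n) (elts (vnat n)))"

text \<open>
  In the absence of choice the cardinality of \<open>x\<close> is the class of all sets equipotent to \<open>x\<close>.
  Here \<open>M\<close> is the class in which cardinalities are computed.
\<close>

definition cardinality :: "'v::zfa_choice set \<Rightarrow> 'v \<Rightarrow> 'v set"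
  where "cardinality M x = {y \<in> M. \<not> is_atom y \<and> (\<exists>f\<in>M. vbijection f x y)}"

definition cardinal_le :: "'v::zfa_choice set \<Rightarrow> 'v set \<Rightarrow> 'v set \<Rightarrow> bool"
  where "cardinal_le M p q \<longleftrightarrow> (\<exists>x\<in>p. \<exists>y\<in>q. \<exists>f\<in>M. vinjection f x y)"

definition cardinal_less :: "'v::zfa_choice set \<Rightarrow> 'v set \<Rightarrow> 'v set \<Rightarrow> bool"
  where "cardinal_less M p q \<longleftrightarrow> cardinal_le M p q \<and> p \<noteq> q"

definition power_in :: "'v::zfa_choice set \<Rightarrow> 'v \<Rightarrow> 'v"
  where "power_in M x = vset {y \<in> M. \<not> is_atom y \<and> elts y \<subseteq> elts x}"

definition fin_in :: "'v::zfa_choice set \<Rightarrow> 'v \<Rightarrow> 'v"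
  where "fin_in M x = vset {y \<in> M. \<not> is_atom y \<and> elts y \<subseteq> elts x \<and>
           (\<exists>n. \<exists>f\<in>M. vbijection f (vnat n) y)}"

definition seq_in :: "'v::zfa_choice set \<Rightarrow> 'v \<Rightarrow> 'v"
  where "seq_in M x = vset {s \<in> M. \<exists>n. vfunction s (vnat n) x}"

definition seq_inj_in :: "'v::zfa_choice set \<Rightarrow> 'v \<Rightarrow> 'v"
  where "seq_inj_in M x = vset {s \<in> M. \<exists>n. vinjection s (vnat n) x}"

end

theory Submission
  imports Defs "HOL-Combinatorics.Multiset_Permutations"
begin

text \<open>
  The automorphisms of a countable dense order are rich enough (by a back-and-forth argument) that the
  supported objects are explicit. For a finite set \<open>E\<close> of \<open>n\<close> atoms, an atom has support \<open>E\<close> iff it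
  lies in \<open>E\<close>, a finite set of atoms iff it is a subset of \<open>E\<close>, a sequence of atoms iff its
  entries lie in \<open>E\<close>, and a set of atoms iff it is a union of points of \<open>E\<close> and of the \<open>n + 1\<close> open
  intervals into which \<open>E\<close> cuts the order (\<open>supports_atom_iff\<close>, \<open>supports_set_iff\<close>, \<open>supports_vseq_iff\<close>).

  A bijection in the model has a finite support, and for every finite \<open>E\<close> that includes this support
  it matches the elements with support \<open>E\<close> of its domain with those of its range
  (\<open>bijection_between_supported_elements\<close>). Adjacent cardinals in the chain are therefore told apart
  by counting: there are \<open>n\<close> atoms with support \<open>E\<close>, \<open>2 ^ n\<close> finite sets, more than
  \<open>2 ^ n\<close> and at most \<open>2 ^ (2 * n + 1)\<close> sets, finitely many but at least \<open>n!\<close> sequences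
  without repetition, and infinitely many sequences when \<open>n > 0\<close>. For \<open>n \<ge> 10\<close> the factorial exceeds
  the power.

  Of the four injections only the one from the sets of atoms into the sequences without repetition is not
  obvious. A set \<open>X\<close> in the model is determined by its boundary \<open>bd X\<close>, which is its least
  support, together with the information which of the points and intervals belong to \<open>X\<close>. Fix a set
  \<open>P\<close> of ten atoms. The number \<open>n\<close> of elements of \<open>P \<union> bd X\<close> is at least ten, and hence
  this information can be coded by a permutation of \<open>n\<close> numbers and finally by a listing of
  \<open>P \<union> bd X\<close> (\<open>encode\<close>). Nothing in this construction depends on more than the order and
  \<open>P\<close>, so the injection has support \<open>P\<close> (\<open>encode_equivariant\<close>).
\<close>

section \<open>Countable dense linear orders without endpoints\<close>

locale countable_dlo =
  fixes A :: "'a set" and R :: "('a \<times> 'a) set"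
  assumes countable_A: "countable A" and infinite_A: "infinite A"
    and dlo: "dense_order_without_endpoints A R"
begin

abbreviation less_R (infix "\<prec>" 50) where "x \<prec> y \<equiv> (x, y) \<in> R"

lemma less_in: "x \<prec> y \<Longrightarrow> x \<in> A \<and> y \<in> A"
  using dlo by (auto simp: dense_order_without_endpoints_def)

lemma less_irrefl: "\<not> x \<prec> x"
  using dlo by (auto simp: dense_order_without_endpoints_def strict_linear_order_on_def irrefl_def)

lemma less_trans: "x \<prec> y \<Longrightarrow> y \<prec> z \<Longrightarrow> x \<prec> z"
  using dlo unfolding dense_order_without_endpoints_def strict_linear_order_on_def
  by (meson transE)

lemma less_asym: "x \<prec> y \<Longrightarrow> \<not> y \<prec> x"
  using less_trans less_irrefl by blast

lemma less_total: "x \<in> A \<Longrightarrow> y \<in> A \<Longrightarrow> x \<prec> y \<or> x = y \<or> y \<prec> x"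
  using dlo by (auto simp: dense_order_without_endpoints_def strict_linear_order_on_def total_on_def)

lemma less_dense: "x \<prec> y \<Longrightarrow> \<exists>z. x \<prec> z \<and> z \<prec> y"
  using dlo by (auto simp: dense_order_without_endpoints_def)

lemma ex_less: "x \<in> A \<Longrightarrow> \<exists>y. y \<prec> x" and ex_greater: "x \<in> A \<Longrightarrow> \<exists>y. x \<prec> y"
  using dlo by (auto simp: dense_order_without_endpoints_def)

lemma finite_max: "finite S \<Longrightarrow> S \<noteq> {} \<Longrightarrow> S \<subseteq> A \<Longrightarrow> \<exists>x\<in>S. \<forall>y\<in>S. y = x \<or> y \<prec> x"
proof (induction S rule: finite_ne_induct)
  case (insert a S)
  then obtain x where "x \<in> S" "\<forall>y\<in>S. y = x \<or> y \<prec> x" by auto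
  moreover from this have "a \<in> A" "x \<in> A" using insert.prems by auto
  ultimately consider "a = x" | "a \<prec> x" | "x \<prec> a" using less_total by blast
  then show ?case
    using \<open>x \<in> S\<close> \<open>\<forall>y\<in>S. y = x \<or> y \<prec> x\<close> less_trans by cases (metis insert_iff)+
qed auto

lemma finite_min: "finite S \<Longrightarrow> S \<noteq> {} \<Longrightarrow> S \<subseteq> A \<Longrightarrow> \<exists>x\<in>S. \<forall>y\<in>S. y = x \<or> x \<prec> y"
proof (induction S rule: finite_ne_induct)
  case (insert a S)
  then obtain x where "x \<in> S" "\<forall>y\<in>S. y = x \<or> x \<prec> y" by auto
  moreover from this have "a \<in> A" "x \<in> A" using insert.prems by auto
  ultimately consider "a = x" | "a \<prec> x" | "x \<prec> a" using less_total by blast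
  then show ?case
    using \<open>x \<in> S\<close> \<open>\<forall>y\<in>S. y = x \<or> x \<prec> y\<close> less_trans by cases (metis insert_iff)+
qed auto

text \<open>
  Density and the absence of endpoints together: every cut between two finite sets is filled, also
  when one of them is empty. This single form serves the back-and-forth argument and all
  constructions of auxiliary points below.
\<close>
lemma ex_between:
  assumes "finite L" "finite U" "L \<subseteq> A" "U \<subseteq> A" "\<And>l u. l \<in> L \<Longrightarrow> u \<in> U \<Longrightarrow> l \<prec> u"
  shows "\<exists>y\<in>A. (\<forall>l\<in>L. l \<prec> y) \<and> (\<forall>u\<in>U. y \<prec> u)"
proof -
  have above: "\<exists>y. (\<forall>l\<in>L. l \<prec> y) \<and> y \<prec> u" if u: "\<forall>l\<in>L. l \<prec> u" "u \<in> A" for u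
  proof (cases "L = {}")
    case True
    then show ?thesis using ex_less[OF u(2)] by blast
  next
    case False
    then obtain l where l: "l \<in> L" "\<forall>y\<in>L. y = l \<or> y \<prec> l" using finite_max[OF assms(1) False assms(3)] by blast
    then obtain y where "l \<prec> y" "y \<prec> u" using less_dense u(1) by blast
    then show ?thesis using l less_trans by metis
  qed
  have "\<exists>u\<in>A. (\<forall>l\<in>L. l \<prec> u) \<and> (\<forall>y\<in>U. y = u \<or> u \<prec> y)"
  proof (cases "U = {}")
    case False
    then show ?thesis using finite_min[OF assms(2) False assms(4)] assms(4,5) by blast
  next
    case True
    show ?thesis
    proof (cases "L = {}")
      case True
      then show ?thesis using \<open>U = {}\<close> infinite_A by (auto simp: ex_in_conv)
    next
      case False
      then obtain l where l: "l \<in> L" "\<forall>y\<in>L. y = l \<or> y \<prec> l" using finite_max[OF assms(1) False assms(3)] by blast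
      then obtain y where "l \<prec> y" using ex_greater assms(3) by blast
      then have "\<forall>z\<in>L. z \<prec> y" "y \<in> A" using l less_trans less_in by metis+
      then show ?thesis using True by blast
    qed
  qed
  then obtain u where u: "u \<in> A" "\<forall>l\<in>L. l \<prec> u" "\<forall>y\<in>U. y = u \<or> u \<prec> y" by blast
  then obtain y where y: "\<forall>l\<in>L. l \<prec> y" "y \<prec> u" using above by blast
  then have "\<forall>z\<in>U. y \<prec> z" "y \<in> A" using u(3) less_trans less_in by metis+
  then show ?thesis using y by blast
qed

subsection \<open>Homogeneity\<close>

definition partial_iso :: "('a \<times> 'a) set \<Rightarrow> bool"
  where "partial_iso p \<longleftrightarrow> finite p \<and> p \<subseteq> A \<times> A \<and>
           (\<forall>x y x' y'. (x, y) \<in> p \<longrightarrow> (x', y') \<in> p \<longrightarrow> (x \<prec> x' \<longleftrightarrow> y \<prec> y'))"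

lemma partial_iso_eq_iff:
  assumes "partial_iso p" "(x, y) \<in> p" "(x', y') \<in> p"
  shows "x = x' \<longleftrightarrow> y = y'"
  using assms less_total[of x x'] less_total[of y y'] less_irrefl unfolding partial_iso_def by blast

lemma partial_iso_converse: "partial_iso (p\<inverse>) \<longleftrightarrow> partial_iso p"
  unfolding partial_iso_def by auto

text \<open>
  The forth step: the image of a new point has to lie in the cut of the range that corresponds to
  the cut of the domain in which the point lies, and every cut is filled.
\<close>
lemma partial_iso_extend_domain:
  assumes p: "partial_iso p" and x: "x \<in> A"
  shows "\<exists>y. partial_iso (insert (x, y) p)"
proof (cases "x \<in> Domain p")
  case True
  then obtain y where "(x, y) \<in> p" by blast
  then show ?thesis using p by (metis insert_absorb)
next
  case False
  define L where "L = {y'. \<exists>x'. (x', y') \<in> p \<and> x' \<prec> x}"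
  define U where "U = {y'. \<exists>x'. (x', y') \<in> p \<and> x \<prec> x'}"
  have fin: "finite (Range p)" and sub: "Range p \<subseteq> A"
    using p by (auto simp: partial_iso_def finite_Range)
  have "L \<subseteq> Range p" "U \<subseteq> Range p" unfolding L_def U_def by auto
  moreover have "l \<prec> u" if lu: "l \<in> L" "u \<in> U" for l u
  proof -
    obtain l' where l': "(l', l) \<in> p" "l' \<prec> x" using lu(1) unfolding L_def by blast
    obtain u' where u': "(u', u) \<in> p" "x \<prec> u'" using lu(2) unfolding U_def by blast
    show ?thesis using p l'(1) u'(1) less_trans[OF l'(2) u'(2)] unfolding partial_iso_def by blast
  qed
  ultimately obtain y where y: "y \<in> A" "\<forall>l\<in>L. l \<prec> y" "\<forall>u\<in>U. y \<prec> u"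
    using ex_between[of L U] finite_subset[OF _ fin] subset_trans[OF _ sub] by metis
  have new: "(x \<prec> x' \<longleftrightarrow> y \<prec> y') \<and> (x' \<prec> x \<longleftrightarrow> y' \<prec> y)" if "(x', y') \<in> p" for x' y'
  proof -
    have "x' \<in> A" "x' \<noteq> x" using that p False unfolding partial_iso_def by auto
    then consider "x' \<prec> x" "y' \<in> L" | "x \<prec> x'" "y' \<in> U"
      using less_total[OF x, of x'] \<open>(x', y') \<in> p\<close> unfolding L_def U_def by blast
    then show ?thesis using y(2,3) less_asym by cases metis+
  qed
  have "partial_iso (insert (x, y) p)"
    unfolding partial_iso_def
  proof (intro conjI allI impI)
    fix u v u' v' assume "(u, v) \<in> insert (x, y) p" "(u', v') \<in> insert (x, y) p"
    then consider "u = x" "v = y" "u' = x" "v' = y" | "u = x" "v = y" "(u', v') \<in> p"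
      | "(u, v) \<in> p" "u' = x" "v' = y" | "(u, v) \<in> p" "(u', v') \<in> p" by blast
    then show "u \<prec> u' \<longleftrightarrow> v \<prec> v'"
    proof cases
      case 1
      then show ?thesis using less_irrefl by simp
    next
      case 2
      then show ?thesis using new by simp
    next
      case 3
      then show ?thesis using new by simp
    next
      case 4
      then show ?thesis using p unfolding partial_iso_def by blast
    qed
  qed (use p x y(1) in \<open>auto simp: partial_iso_def\<close>)
  then show ?thesis by (rule exI)
qed

lemma partial_iso_extend:
  assumes "partial_iso p" and "a \<in> A"
  shows "\<exists>q. partial_iso q \<and> p \<subseteq> q \<and> a \<in> Domain q \<and> a \<in> Range q"
proof -
  obtain y where y: "partial_iso (insert (a, y) p)"
    using partial_iso_extend_domain[OF assms] by (elim exE)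
  then have "partial_iso ((insert (a, y) p)\<inverse>)" by (simp only: partial_iso_converse)
  then obtain x where "partial_iso (insert (a, x) ((insert (a, y) p)\<inverse>))"
    using partial_iso_extend_domain[OF _ assms(2)] by meson
  moreover have "insert (a, x) ((insert (a, y) p)\<inverse>) = (insert (x, a) (insert (a, y) p))\<inverse>" by auto
  ultimately have "partial_iso ((insert (x, a) (insert (a, y) p))\<inverse>)" by (simp only:)
  then have "partial_iso (insert (x, a) (insert (a, y) p))" by (simp only: partial_iso_converse)
  then show ?thesis by blast
qed

text \<open>
  Cantor's back-and-forth argument. The union of a chain of finite partial isomorphisms, the
  \<open>n\<close>-th step of which puts the \<open>n\<close>-th point of an enumeration of \<open>A\<close> into domain and range, is an
  automorphism.
\<close>
lemma partial_iso_extends_to_automorphism: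
  assumes p: "partial_iso p"
  shows "\<exists>\<pi>\<in>order_automorphisms A R. \<forall>(x, y)\<in>p. \<pi> x = y"
proof -
  define e where "e = from_nat_into A"
  have A_ne: "A \<noteq> {}" using infinite_A by auto
  have e: "range e = A" "\<And>n. e n \<in> A"
    using countable_A A_ne by (simp_all add: e_def from_nat_into)
  have "\<exists>q. \<forall>n. (partial_iso (q n) \<and> (n = 0 \<longrightarrow> q n = p)) \<and>
      (q n \<subseteq> q (Suc n) \<and> e n \<in> Domain (q (Suc n)) \<and> e n \<in> Range (q (Suc n)))"
    by (rule dependent_nat_choice) (use p partial_iso_extend e in auto)
  then obtain q where q: "q 0 = p" "\<And>n. partial_iso (q n)" "\<And>n. q n \<subseteq> q (Suc n)"
    "\<And>n. e n \<in> Domain (q (Suc n))" "\<And>n. e n \<in> Range (q (Suc n))" by blast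
  have mono: "q i \<subseteq> q j" if "i \<le> j" for i j
    using lift_Suc_mono_le[of q] q(3) that by blast
  define g where "g = (\<Union>n. q n)"
  have common: "\<exists>n. (x, y) \<in> q n \<and> (x', y') \<in> q n" if xy: "(x, y) \<in> g" "(x', y') \<in> g" for x y x' y'
  proof -
    obtain i where "(x, y) \<in> q i" using xy(1) unfolding g_def by blast
    moreover obtain j where "(x', y') \<in> q j" using xy(2) unfolding g_def by blast
    ultimately show ?thesis using mono[of i "max i j"] mono[of j "max i j"] by (meson max.cobounded1 max.cobounded2 subsetD)
  qed
  have g_eq: "x = x' \<longleftrightarrow> y = y'" and g_less: "x \<prec> x' \<longleftrightarrow> y \<prec> y'"
    if xy: "(x, y) \<in> g" "(x', y') \<in> g" for x y x' y'
  proof -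
    obtain n where n: "(x, y) \<in> q n" "(x', y') \<in> q n" using common[OF xy] by blast
    show "x = x' \<longleftrightarrow> y = y'" using partial_iso_eq_iff[OF q(2) n] .
    show "x \<prec> x' \<longleftrightarrow> y \<prec> y'" using q(2)[of n] n unfolding partial_iso_def by blast
  qed
  have g_sub: "g \<subseteq> A \<times> A" using q(2) unfolding g_def partial_iso_def by blast
  have dom: "\<exists>y. (x, y) \<in> g" and ran: "\<exists>y. (y, x) \<in> g" if x: "x \<in> A" for x
  proof -
    obtain n where "x = e n" using x e(1) by blast
    then show "\<exists>y. (x, y) \<in> g" "\<exists>y. (y, x) \<in> g" using q(4,5)[of n] unfolding g_def by blast+
  qed
  define \<pi> where "\<pi> x = (if x \<in> A then THE y. (x, y) \<in> g else x)" for x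
  have \<pi>: "\<pi> x = y" if "(x, y) \<in> g" for x y
  proof -
    have "(THE y. (x, y) \<in> g) = y" using that g_eq by (intro the_equality) blast+
    then show ?thesis using that g_sub by (auto simp: \<pi>_def)
  qed
  have "bij_betw \<pi> A A"
    unfolding bij_betw_def
  proof
    show "inj_on \<pi> A"
      by (intro inj_onI) (metis dom \<pi> g_eq)
    show "\<pi> ` A = A"
    proof
      show "\<pi> ` A \<subseteq> A"
      proof
        fix b assume "b \<in> \<pi> ` A"
        then obtain a where "a \<in> A" "b = \<pi> a" by blast
        then show "b \<in> A" using dom[of a] \<pi> g_sub by blast
      qed
      show "A \<subseteq> \<pi> ` A" using ran \<pi> g_sub by blast
    qed
  qed
  then have "\<pi> permutes A" by (intro bij_imp_permutes) (auto simp: \<pi>_def)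
  moreover have "\<pi> x \<prec> \<pi> y \<longleftrightarrow> x \<prec> y" if "x \<in> A" "y \<in> A" for x y
    using that dom \<pi> g_less by metis
  ultimately have "\<pi> \<in> order_automorphisms A R" unfolding order_automorphisms_def by blast
  moreover have "\<forall>(x, y)\<in>p. \<pi> x = y" using \<pi> q(1) unfolding g_def by blast
  ultimately show ?thesis by blast
qed

subsection \<open>Sets that are definable from finitely many points\<close>

text \<open>
  By homogeneity, \<open>same_cut E\<close> is the orbit relation of the group of automorphisms that fix \<open>E\<close>
  pointwise. Its classes are the points of \<open>E\<close> and the finitely many open intervals between them.
\<close>
definition same_cut :: "'a set \<Rightarrow> 'a \<Rightarrow> 'a \<Rightarrow> bool"
  where "same_cut E a b \<longleftrightarrow> (\<forall>e\<in>E. (e \<prec> a \<longleftrightarrow> e \<prec> b) \<and> (a \<prec> e \<longleftrightarrow> b \<prec> e))"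

lemma same_cut_sym: "same_cut E a b \<Longrightarrow> same_cut E b a"
  and same_cut_trans: "same_cut E a b \<Longrightarrow> same_cut E b c \<Longrightarrow> same_cut E a c"
  unfolding same_cut_def by blast+

lemma same_cut_in: "same_cut E a b \<Longrightarrow> a \<in> A \<Longrightarrow> b \<in> A \<Longrightarrow> a \<in> E \<Longrightarrow> b = a"
  unfolding same_cut_def using less_total less_irrefl by blast

lemma same_cutI:
  assumes "a \<prec> b" "\<And>f. f \<in> E \<Longrightarrow> f \<prec> a \<or> b \<prec> f"
  shows "same_cut E a b"
  unfolding same_cut_def
proof
  fix f assume "f \<in> E"
  with assms(2) consider "f \<prec> a" | "b \<prec> f" by blast
  then show "(f \<prec> a \<longleftrightarrow> f \<prec> b) \<and> (a \<prec> f \<longleftrightarrow> b \<prec> f)"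
    using assms(1) less_trans less_asym by cases metis+
qed

text \<open>
  The identity on \<open>E\<close> together with the pair of \<open>a\<close> and \<open>b\<close> is a finite partial isomorphism.
\<close>
lemma automorphism_same_cut:
  assumes "finite E" "E \<subseteq> A" "a \<in> A" "b \<in> A" "same_cut E a b"
  shows "\<exists>\<pi>\<in>order_automorphisms A R. (\<forall>e\<in>E. \<pi> e = e) \<and> \<pi> a = b"
proof -
  have "partial_iso (insert (a, b) (Id_on E))"
    using assms less_irrefl unfolding partial_iso_def same_cut_def by (auto simp: Id_on_def)
  from partial_iso_extends_to_automorphism[OF this] obtain \<pi> where
    "\<pi> \<in> order_automorphisms A R" "\<forall>(x, y)\<in>insert (a, b) (Id_on E). \<pi> x = y" by blast
  then show ?thesis by (intro bexI[of _ \<pi>]) (auto simp: Id_on_def)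
qed

lemma automorphism_imp_same_cut:
  assumes "\<pi> \<in> order_automorphisms A R" "\<And>e. e \<in> E \<Longrightarrow> \<pi> e = e" "E \<subseteq> A" "a \<in> A"
  shows "same_cut E a (\<pi> a)"
  unfolding same_cut_def
proof
  fix e assume e: "e \<in> E"
  have "\<pi> x \<prec> \<pi> y \<longleftrightarrow> x \<prec> y" if "x \<in> A" "y \<in> A" for x y
    using that assms(1) unfolding order_automorphisms_def by blast
  from this[of e a] this[of a e] show "(e \<prec> a \<longleftrightarrow> e \<prec> \<pi> a) \<and> (a \<prec> e \<longleftrightarrow> \<pi> a \<prec> e)"
    using assms(2)[OF e] assms(3,4) e by auto
qed

lemma ex_neighbourhood_same_cut:
  assumes "finite E" "E \<subseteq> A" "a \<in> A" "a \<notin> E"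
  shows "\<exists>l r. l \<prec> a \<and> a \<prec> r \<and> (\<forall>c. l \<prec> c \<longrightarrow> c \<prec> r \<longrightarrow> same_cut E a c)"
proof -
  have "\<exists>l\<in>A. (\<forall>e\<in>{e\<in>E. e \<prec> a}. e \<prec> l) \<and> (\<forall>u\<in>{a}. l \<prec> u)"
    by (rule ex_between) (use assms(1-3) in auto)
  then obtain l where l: "l \<prec> a" "\<forall>e\<in>E. e \<prec> a \<longrightarrow> e \<prec> l" by blast
  have "\<exists>r\<in>A. (\<forall>l\<in>{a}. l \<prec> r) \<and> (\<forall>e\<in>{e\<in>E. a \<prec> e}. r \<prec> e)"
    by (rule ex_between) (use assms(1-3) in auto)
  then obtain r where r: "a \<prec> r" "\<forall>e\<in>E. a \<prec> e \<longrightarrow> r \<prec> e" by blast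
  have "same_cut E a c" if c: "l \<prec> c" "c \<prec> r" for c
    unfolding same_cut_def
  proof
    fix e assume e: "e \<in> E"
    then consider "e \<prec> a" | "a \<prec> e" using assms less_total by blast
    then show "(e \<prec> a \<longleftrightarrow> e \<prec> c) \<and> (a \<prec> e \<longleftrightarrow> c \<prec> e)"
      using l r c e less_trans less_asym by cases metis+
  qed
  then show ?thesis using l r by blast
qed

lemma infinite_interval:
  assumes "l \<prec> r"
  shows "infinite {c. l \<prec> c \<and> c \<prec> r}"
proof
  assume "finite {c. l \<prec> c \<and> c \<prec> r}"
  then have "\<exists>y\<in>A. (\<forall>c\<in>insert l {c. l \<prec> c \<and> c \<prec> r}. c \<prec> y) \<and> (\<forall>u\<in>{r}. y \<prec> u)"
    by (intro ex_between) (use assms less_in in auto)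
  then show False using less_irrefl by blast
qed

lemma infinite_same_cut:
  assumes "finite E" "E \<subseteq> A" "a \<in> A" "a \<notin> E"
  shows "infinite {c\<in>A. same_cut E a c}"
proof -
  obtain l r where lr: "l \<prec> a" "a \<prec> r" "\<forall>c. l \<prec> c \<longrightarrow> c \<prec> r \<longrightarrow> same_cut E a c"
    using ex_neighbourhood_same_cut[OF assms] by blast
  then have "{c. l \<prec> c \<and> c \<prec> r} \<subseteq> {c\<in>A. same_cut E a c}" using less_in by blast
  then show ?thesis using infinite_interval[OF less_trans[OF lr(1,2)]] infinite_super by blast
qed

text \<open>
  The sets of points that are supported by \<open>E\<close>, described without reference to automorphisms;
  the equivalence is \<open>determined_iff_invariant\<close>.
\<close>
definition determined :: "'a set \<Rightarrow> 'a set \<Rightarrow> bool"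
  where "determined E X \<longleftrightarrow> (\<forall>a\<in>A. \<forall>b\<in>A. same_cut E a b \<longrightarrow> (a \<in> X \<longleftrightarrow> b \<in> X))"

lemma determined_mono: "determined E X \<Longrightarrow> E \<subseteq> F \<Longrightarrow> determined F X"
  unfolding determined_def same_cut_def by blast

lemma determined_subset: "Y \<subseteq> E \<Longrightarrow> E \<subseteq> A \<Longrightarrow> determined E Y"
  unfolding determined_def using same_cut_in same_cut_sym by blast

text \<open>
  A class of \<open>same_cut E\<close> outside \<open>E\<close> is an interval and hence infinite, so it is not contained in a
  finite set.
\<close>
lemma finite_determined_iff:
  assumes "finite E" "E \<subseteq> A" "finite Y" "Y \<subseteq> A"
  shows "determined E Y \<longleftrightarrow> Y \<subseteq> E"
proof
  assume det: "determined E Y"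
  show "Y \<subseteq> E"
  proof (rule ccontr)
    assume "\<not> Y \<subseteq> E"
    then obtain a where a: "a \<in> Y" "a \<notin> E" by blast
    then have "{c\<in>A. same_cut E a c} \<subseteq> Y" using det assms unfolding determined_def by blast
    then show False using infinite_same_cut[of E a] a assms finite_subset by blast
  qed
qed (use determined_subset assms in blast)

lemma determined_iff_invariant:
  assumes "finite E" "E \<subseteq> A" "X \<subseteq> A"
  shows "determined E X \<longleftrightarrow>
    (\<forall>\<pi>\<in>order_automorphisms A R. (\<forall>e\<in>E. \<pi> e = e) \<longrightarrow> \<pi> ` X = X)"
proof
  assume det: "determined E X"
  show "\<forall>\<pi>\<in>order_automorphisms A R. (\<forall>e\<in>E. \<pi> e = e) \<longrightarrow> \<pi> ` X = X"
  proof (intro ballI impI)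
    fix \<pi> assume \<pi>: "\<pi> \<in> order_automorphisms A R" "\<forall>e\<in>E. \<pi> e = e"
    have perm: "\<pi> permutes A" using \<pi> unfolding order_automorphisms_def by blast
    have iff: "\<pi> a \<in> X \<longleftrightarrow> a \<in> X" if "a \<in> A" for a
      using automorphism_imp_same_cut[OF \<pi>(1) _ assms(2) that] \<pi>(2) that det
        permutes_in_image[OF perm, of a] unfolding determined_def by blast
    show "\<pi> ` X = X"
    proof
      show "X \<subseteq> \<pi> ` X"
      proof
        fix b assume b: "b \<in> X"
        then obtain a where "a \<in> A" "b = \<pi> a"
          using assms(3) permutes_image[OF perm] by (metis image_iff subsetD)
        then show "b \<in> \<pi> ` X" using iff b by blast
      qed
    qed (use iff assms(3) in blast)
  qed
next
  assume inv: "\<forall>\<pi>\<in>order_automorphisms A R. (\<forall>e\<in>E. \<pi> e = e) \<longrightarrow> \<pi> ` X = X"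
  have "b \<in> X" if "a \<in> A" "b \<in> A" "same_cut E a b" "a \<in> X" for a b
    using automorphism_same_cut[OF assms(1,2) that(1-3)] inv that(4) by blast
  then show "determined E X" unfolding determined_def using same_cut_sym by blast
qed

text \<open>
  The boundary of \<open>X\<close> in the order topology: the points at which membership in \<open>X\<close> is not
  locally constant. For a set determined by some finite set it is the least finite set that
  determines it, as the next lemmas show. Its definition makes no choice, so it commutes with
  automorphisms.
\<close>
definition bd :: "'a set \<Rightarrow> 'a set"
  where "bd X = {a\<in>A. \<forall>l r. l \<prec> a \<longrightarrow> a \<prec> r \<longrightarrow> (\<exists>c. l \<prec> c \<and> c \<prec> r \<and> (c \<in> X \<longleftrightarrow> a \<notin> X))}"

lemma bd_subset_A: "bd X \<subseteq> A" unfolding bd_def by blast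

lemma bd_subset:
  assumes "finite E" "E \<subseteq> A" "determined E X"
  shows "bd X \<subseteq> E"
proof
  fix a assume a: "a \<in> bd X"
  show "a \<in> E"
  proof (rule ccontr)
    assume "a \<notin> E"
    moreover have "a \<in> A" using a bd_subset_A by blast
    ultimately obtain l r where "l \<prec> a" "a \<prec> r" "\<forall>c. l \<prec> c \<longrightarrow> c \<prec> r \<longrightarrow> same_cut E a c"
      using ex_neighbourhood_same_cut[OF assms(1,2)] by blast
    then show False using a assms(3) less_in unfolding bd_def determined_def by blast
  qed
qed

text \<open>
  Near a point \<open>e\<close> that is not in the boundary, \<open>X\<close> is constant, and this neighbourhood meets both
  intervals adjacent to \<open>e\<close>. The two intervals and \<open>e\<close> therefore merge into one class on which \<open>X\<close>
  is constant.
\<close>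
lemma determined_remove:
  assumes E: "E \<subseteq> A" and det: "determined E X" and e: "e \<in> E" "e \<notin> bd X"
  shows "determined (E - {e}) X"
proof -
  have eA: "e \<in> A" using E e by blast
  obtain l r where lr: "l \<prec> e" "e \<prec> r" "\<And>c. l \<prec> c \<Longrightarrow> c \<prec> r \<Longrightarrow> c \<in> X \<longleftrightarrow> e \<in> X"
    using e eA unfolding bd_def by blast
  \<comment> \<open>Membership of \<open>a\<close> is carried to a point \<open>a'\<close> of the same interval so close to \<open>e\<close> that
    \<open>X\<close> is constant between them.\<close>
  have to_e: "a \<in> X \<longleftrightarrow> e \<in> X" if a: "a \<in> A" "same_cut (E - {e}) a e" for a
  proof -
    consider "a = e" | "a \<prec> e" | "e \<prec> a" using less_total a(1) eA by blast
    then show ?thesis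
    proof cases
      case 2
      then have "\<exists>a'\<in>A. (\<forall>x\<in>{l, a}. x \<prec> a') \<and> (\<forall>x\<in>{e}. a' \<prec> x)"
        by (intro ex_between) (use lr(1) less_in in auto)
      then obtain a' where a': "l \<prec> a'" "a \<prec> a'" "a' \<prec> e" by blast
      have "same_cut E a a'"
      proof (rule same_cutI)
        fix f assume f: "f \<in> E"
        then have "f \<in> A" using E by blast
        then consider "f = e" | "f \<noteq> e" "f \<prec> e" | "f \<noteq> e" "e \<prec> f" using less_total eA by blast
        then show "f \<prec> a \<or> a' \<prec> f"
          using a'(3) a(2) f less_trans[OF a'(3)] unfolding same_cut_def by cases auto
      qed (fact a')
      then have "a \<in> X \<longleftrightarrow> a' \<in> X" using det a(1) a' less_in unfolding determined_def by blast
      then show ?thesis using lr a' less_trans by metis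
    next
      case 3
      then have "\<exists>a'\<in>A. (\<forall>x\<in>{e}. x \<prec> a') \<and> (\<forall>x\<in>{r, a}. a' \<prec> x)"
        by (intro ex_between) (use lr(2) less_in in auto)
      then obtain a' where a': "a' \<prec> r" "a' \<prec> a" "e \<prec> a'" by blast
      have "same_cut E a a'"
      proof (intro same_cut_sym[OF same_cutI])
        fix f assume f: "f \<in> E"
        then have "f \<in> A" using E by blast
        then consider "f = e" | "f \<noteq> e" "f \<prec> e" | "f \<noteq> e" "e \<prec> f" using less_total eA by blast
        then show "f \<prec> a' \<or> a \<prec> f"
          using a'(3) a(2) f less_trans[OF _ a'(3)] unfolding same_cut_def by cases auto
      qed (fact a')
      then have "a \<in> X \<longleftrightarrow> a' \<in> X" using det a(1) a' less_in unfolding determined_def by blast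
      then show ?thesis using lr a' less_trans by metis
    qed simp
  qed
  have "a \<in> X \<longleftrightarrow> b \<in> X" if ab: "a \<in> A" "b \<in> A" "same_cut (E - {e}) a b" for a b
  proof (cases "same_cut E a b")
    case True
    then show ?thesis using det ab unfolding determined_def by blast
  next
    case False
    \<comment> \<open>Only \<open>e\<close> can separate \<open>a\<close> and \<open>b\<close>, so both belong to the class of \<open>e\<close>.\<close>
    then have sep: "\<not> ((e \<prec> a \<longleftrightarrow> e \<prec> b) \<and> (a \<prec> e \<longleftrightarrow> b \<prec> e))"
      using ab(3) unfolding same_cut_def by blast
    have cut: "f \<in> A" "f \<noteq> e" "f \<noteq> a" "f \<prec> a \<longleftrightarrow> f \<prec> b" "a \<prec> f \<longleftrightarrow> b \<prec> f" if "f \<in> E - {e}" for f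
      using that E ab sep same_cut_in[OF ab(3,1,2)] unfolding same_cut_def by auto
    consider "a = e" | "a \<prec> e" | "e \<prec> a" using less_total ab(1) eA by blast
    then have "same_cut (E - {e}) a e"
    proof cases
      case 1
      then show ?thesis by (simp add: same_cut_def)
    next
      case 2
      then have b: "b = e \<or> e \<prec> b" using sep less_asym less_total[OF ab(2) eA] by blast
      show ?thesis
      proof (rule same_cutI[OF 2])
        fix f assume "f \<in> E - {e}"
        note cut = cut[OF this]
        show "f \<prec> a \<or> e \<prec> f"
          using cut b less_total[OF cut(1) ab(1)] less_total[OF cut(1) eA] less_trans by metis
      qed
    next
      case 3
      then have b: "b = e \<or> b \<prec> e" using sep less_asym less_total[OF ab(2) eA] by blast
      show ?thesis
      proof (rule same_cut_sym[OF same_cutI[OF 3]])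
        fix f assume "f \<in> E - {e}"
        note cut = cut[OF this]
        show "f \<prec> e \<or> a \<prec> f"
          using cut b less_total[OF cut(1) ab(1)] less_total[OF cut(1) eA] less_trans by metis
      qed
    qed
    then show ?thesis using to_e ab same_cut_sym same_cut_trans by meson
  qed
  then show ?thesis unfolding determined_def by blast
qed

text \<open>
  By \<open>determined_remove\<close>, a determining set of least cardinality consists of boundary points.
\<close>
lemma determined_bd:
  assumes "finite E" "E \<subseteq> A" "determined E X"
  shows "determined (bd X) X"
proof -
  let ?P = "\<lambda>E. finite E \<and> E \<subseteq> A \<and> determined E X"
  obtain F where F: "?P F" "\<And>F'. ?P F' \<Longrightarrow> card F \<le> card F'"
    using ex_has_least_nat[of ?P E card] assms by blast
  have "F \<subseteq> bd X"
  proof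
    fix e assume e: "e \<in> F"
    show "e \<in> bd X"
    proof (rule ccontr)
      assume "e \<notin> bd X"
      then have "card F \<le> card (F - {e})" using F e determined_remove by blast
      then show False using F(1) e by (meson card_Diff1_less leD)
    qed
  qed
  then show ?thesis using F(1) determined_mono by blast
qed

subsection \<open>Coding definable sets by injective sequences\<close>

definition rank :: "'a set \<Rightarrow> 'a \<Rightarrow> nat"
  where "rank F a = card {b\<in>F. b \<prec> a}"

text \<open>
  For a finite set \<open>F\<close> this pair of a number and a truth value identifies the class of \<open>a\<close> under
  \<open>same_cut F\<close>. The names of the classes are independent of \<open>F\<close>, so that automorphisms preserve them.
\<close>
definition cut_type :: "'a set \<Rightarrow> 'a \<Rightarrow> nat \<times> bool"
  where "cut_type F a = (rank F a, a \<in> F)"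

lemma cut_type_eq_imp_same_cut_less:
  assumes F: "finite F" "F \<subseteq> A" and ab: "a \<in> A" "b \<in> A" "cut_type F a = cut_type F b" "a \<prec> b"
  shows "same_cut F a b"
proof -
  have "{f\<in>F. f \<prec> a} \<subseteq> {f\<in>F. f \<prec> b}" using less_trans[OF _ ab(4)] by blast
  then have eq: "{f\<in>F. f \<prec> a} = {f\<in>F. f \<prec> b}"
    using ab(3) F(1) unfolding cut_type_def rank_def by (intro card_subset_eq) auto
  then have "a \<notin> F" using ab(4) less_irrefl by blast
  then have "b \<notin> F" using ab(3) unfolding cut_type_def by simp
  show ?thesis
    unfolding same_cut_def
  proof
    fix f assume f: "f \<in> F"
    then have "f \<in> A" "f \<noteq> a" "f \<noteq> b" using F \<open>a \<notin> F\<close> \<open>b \<notin> F\<close> by auto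
    moreover have "f \<prec> a \<longleftrightarrow> f \<prec> b" using eq f by blast
    ultimately show "(f \<prec> a \<longleftrightarrow> f \<prec> b) \<and> (a \<prec> f \<longleftrightarrow> b \<prec> f)"
      using less_total ab(1,2) less_asym by blast
  qed
qed

lemma cut_type_eq_imp_same_cut:
  assumes "finite F" "F \<subseteq> A" "a \<in> A" "b \<in> A" "cut_type F a = cut_type F b"
  shows "same_cut F a b"
  using less_total[OF assms(3,4)] cut_type_eq_imp_same_cut_less[OF assms(1,2)] assms
    same_cut_sym by (metis same_cut_def)

lemma rank_less_card:
  assumes "finite F" "a \<in> F" shows "rank F a < card F"
  unfolding rank_def using assms less_irrefl by (intro psubset_card_mono) auto

lemma rank_le_card: "finite F \<Longrightarrow> rank F a \<le> card F"
  unfolding rank_def by (intro card_mono) auto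

lemma bij_betw_rank:
  assumes "finite F" "F \<subseteq> A"
  shows "bij_betw (rank F) F {..<card F}"
proof -
  have inj: "inj_on (rank F) F"
  proof (rule inj_onI)
    fix a b assume "a \<in> F" "b \<in> F" "rank F a = rank F b"
    then show "a = b"
      using cut_type_eq_imp_same_cut[OF assms, of a b] same_cut_in[of F a b] assms
      unfolding cut_type_def by auto
  qed
  moreover have "rank F ` F = {..<card F}"
    using inj rank_less_card[OF assms(1)] by (intro card_subset_eq) (auto simp: card_image)
  ultimately show ?thesis unfolding bij_betw_def by blast
qed

text \<open>
  With \<open>n\<close> points there are \<open>n + 1\<close> intervals, which may have any rank, and \<open>n\<close> points, which have
  ranks below \<open>n\<close>.
\<close>
definition cut_types :: "nat \<Rightarrow> (nat \<times> bool) set"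
  where "cut_types n = {..n} \<times> {False} \<union> {..<n} \<times> {True}"

lemma finite_cut_types: "finite (cut_types n)" and card_cut_types: "card (cut_types n) = 2 * n + 1"
proof -
  show "finite (cut_types n)" unfolding cut_types_def by simp
  have "card (cut_types n) = card ({..n} \<times> {False}) + card ({..<n} \<times> {True})"
    unfolding cut_types_def by (intro card_Un_disjoint) auto
  then show "card (cut_types n) = 2 * n + 1" by (simp add: card_cartesian_product)
qed

lemma cut_type_in: "finite F \<Longrightarrow> cut_type F a \<in> cut_types (card F)"
  unfolding cut_type_def cut_types_def using rank_less_card rank_le_card by auto

lemma inj_on_cut_types_of:
  assumes "finite F" "F \<subseteq> A"
  shows "inj_on (\<lambda>X. cut_type F ` X) {X. X \<subseteq> A \<and> determined F X}"
proof (rule inj_onI)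
  fix X Y assume X: "X \<in> {X. X \<subseteq> A \<and> determined F X}" and Y: "Y \<in> {X. X \<subseteq> A \<and> determined F X}"
    and eq: "cut_type F ` X = cut_type F ` Y"
  have *: "b \<in> Y" if XY: "cut_type F ` X \<subseteq> cut_type F ` Y" "Y \<subseteq> A" "X \<subseteq> A" "determined F Y" "b \<in> X" for X Y b
  proof -
    obtain a where a: "a \<in> Y" "cut_type F b = cut_type F a" using XY(1,5) by blast
    have "a \<in> A" "b \<in> A" using a(1) XY(2,3,5) by auto
    then show ?thesis
      using cut_type_eq_imp_same_cut[OF assms _ _ a(2)] XY(4) a(1) unfolding determined_def by blast
  qed
  have "X \<subseteq> Y" by (intro subsetI, rule *[of X Y]) (use X Y eq in auto)
  moreover have "Y \<subseteq> X" by (intro subsetI, rule *[of Y X]) (use X Y eq in auto)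
  ultimately show "X = Y" ..
qed

lemma card_determined_le:
  assumes "finite F" "F \<subseteq> A"
  shows "finite {X. X \<subseteq> A \<and> determined F X}" "card {X. X \<subseteq> A \<and> determined F X} \<le> 2 ^ (2 * card F + 1)"
proof -
  have sub: "(\<lambda>X. cut_type F ` X) ` {X. X \<subseteq> A \<and> determined F X} \<subseteq> Pow (cut_types (card F))"
    using cut_type_in[OF assms(1)] by auto
  have fin: "finite (Pow (cut_types (card F)))" using finite_cut_types by simp
  show "finite {X. X \<subseteq> A \<and> determined F X}"
    using inj_on_finite[OF inj_on_cut_types_of[OF assms] sub fin] .
  show "card {X. X \<subseteq> A \<and> determined F X} \<le> 2 ^ (2 * card F + 1)"
    using card_inj_on_le[OF inj_on_cut_types_of[OF assms] sub fin]
    by (simp add: card_Pow finite_cut_types card_cut_types)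
qed

text \<open>
  Ten is the least \<open>n\<close> at which the number of permutations of \<open>n\<close> points exceeds the bound on the
  number of sets determined by them; this is where the number of parameters in \<open>encode\<close> comes from.
\<close>
lemma pow_less_fact: "10 \<le> n \<Longrightarrow> (2::nat) ^ (2 * n + 1) < fact n"
proof (induction n rule: dec_induct)
  case base
  show ?case by (simp add: fact_numeral)
next
  case (step n)
  have "(2::nat) ^ (2 * Suc n + 1) = 4 * 2 ^ (2 * n + 1)" by simp
  also have "\<dots> < 4 * fact n" using step by simp
  also have "\<dots> \<le> Suc n * fact n" using step by (intro mult_right_mono) auto
  finally show ?case by simp
qed

text \<open>
  One injection for each \<open>n\<close> suffices, because it acts on names of classes and on numbers rather than
  on points; an arbitrary choice therefore does not spoil equivariance.
\<close>
definition perm_code :: "nat \<Rightarrow> (nat \<times> bool) set \<Rightarrow> nat list"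
  where "perm_code n = (SOME j. inj_on j (Pow (cut_types n)) \<and>
           j ` Pow (cut_types n) \<subseteq> permutations_of_set {..<n})"

lemma perm_code:
  assumes "10 \<le> n"
  shows "inj_on (perm_code n) (Pow (cut_types n))"
    "perm_code n ` Pow (cut_types n) \<subseteq> permutations_of_set {..<n}"
proof -
  have "card (Pow (cut_types n)) \<le> card (permutations_of_set {..<n})"
    using pow_less_fact[OF assms] by (simp add: card_Pow finite_cut_types card_cut_types)
  then have "\<exists>j. inj_on j (Pow (cut_types n)) \<and> j ` Pow (cut_types n) \<subseteq> permutations_of_set {..<n}"
    using card_le_inj[of "Pow (cut_types n)" "permutations_of_set {..<n}"] finite_cut_types by auto
  from someI_ex[OF this] show "inj_on (perm_code n) (Pow (cut_types n))"
    "perm_code n ` Pow (cut_types n) \<subseteq> permutations_of_set {..<n}"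
    unfolding perm_code_def by blast+
qed

text \<open>
  The parameters \<open>P\<close> are added to the boundary of \<open>X\<close> to have at least ten points. The
  sequence lists these points in an order that encodes which classes of
  \<open>same_cut (P \<union> bd X)\<close> make up \<open>X\<close>. As a sequence without repetition it contains both the set of its entries, and hence \<open>P \<union> bd X\<close>, and
  the code.
\<close>
definition encode :: "'a set \<Rightarrow> 'a set \<Rightarrow> 'a list"
  where "encode P X = (let F = P \<union> bd X in
           map (inv_into F (rank F)) (perm_code (card F) (cut_type F ` X)))"

context
  fixes P assumes P: "finite P" "P \<subseteq> A" "10 \<le> card P"
begin

lemma finite_encode_base:
  assumes "finite E" "E \<subseteq> A" "determined E X"
  shows "finite (P \<union> bd X)" "P \<union> bd X \<subseteq> A" "10 \<le> card (P \<union> bd X)" "determined (P \<union> bd X) X"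
proof -
  have "finite (bd X)" using bd_subset[OF assms] assms(1) finite_subset by blast
  then show fin: "finite (P \<union> bd X)" using P by blast
  show "P \<union> bd X \<subseteq> A" using P bd_subset_A by blast
  show "10 \<le> card (P \<union> bd X)" using P(3) card_mono[OF fin, of P] by simp
  show "determined (P \<union> bd X) X" using determined_bd[OF assms] determined_mono by blast
qed

lemma encode_permutation:
  assumes "finite E" "E \<subseteq> A" "determined E X"
  shows "distinct (encode P X)" "set (encode P X) = P \<union> bd X"
    "map (rank (P \<union> bd X)) (encode P X) =
       perm_code (card (P \<union> bd X)) (cut_type (P \<union> bd X) ` X)"
proof -
  let ?F = "P \<union> bd X" and ?c = "perm_code (card (P \<union> bd X)) (cut_type (P \<union> bd X) ` X)"
  note F = finite_encode_base[OF assms]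
  have bij: "bij_betw (inv_into ?F (rank ?F)) {..<card ?F} ?F"
    using bij_betw_rank F bij_betw_inv_into by blast
  have "cut_type ?F ` X \<in> Pow (cut_types (card ?F))" using cut_type_in F by blast
  then have "?c \<in> permutations_of_set {..<card ?F}" using perm_code(2)[OF F(3)] by blast
  then have c: "set ?c = {..<card ?F}" "distinct ?c" by (auto dest: permutations_of_setD)
  show "distinct (encode P X)" "set (encode P X) = ?F"
    unfolding encode_def Let_def using c bij by (auto simp: distinct_map bij_betw_def)
  have "rank ?F (inv_into ?F (rank ?F) i) = i" if "i \<in> set ?c" for i
    using bij_betw_inv_into_right[OF bij_betw_rank[OF F(1,2)]] that c by blast
  then show "map (rank ?F) (encode P X) = ?c"
    unfolding encode_def Let_def by (simp add: map_idI)
qed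

text \<open>
  The entries of the sequence recover \<open>P \<union> bd X\<close>, and their order recovers the classes that
  make up \<open>X\<close>.
\<close>
lemma encode_inj:
  assumes X: "finite E" "E \<subseteq> A" "determined E X" "X \<subseteq> A"
    and Y: "finite E'" "E' \<subseteq> A" "determined E' Y" "Y \<subseteq> A"
    and eq: "encode P X = encode P Y"
  shows "X = Y"
proof -
  define F where "F = P \<union> bd X"
  have F': "F = P \<union> bd Y"
    using encode_permutation(2)[OF X(1-3)] encode_permutation(2)[OF Y(1-3)] eq F_def by simp
  note F = finite_encode_base[OF X(1-3), folded F_def] finite_encode_base(4)[OF Y(1-3), folded F']
  have "perm_code (card F) (cut_type F ` X) = perm_code (card F) (cut_type F ` Y)"
    using encode_permutation(3)[OF X(1-3), folded F_def] encode_permutation(3)[OF Y(1-3), folded F'] eq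
    by simp
  then have "cut_type F ` X = cut_type F ` Y"
    by (rule inj_onD[OF perm_code(1)[OF F(3)]]) (use cut_type_in[OF F(1)] in auto)
  then show "X = Y"
    by (rule inj_onD[OF inj_on_cut_types_of[OF F(1,2)]]) (use F(4,5) X(4) Y(4) in simp_all)
qed

end

context
  fixes \<pi> assumes \<pi>: "\<pi> \<in> order_automorphisms A R"
begin

lemma automorphism_permutes: "\<pi> permutes A"
  and automorphism_less: "a \<in> A \<Longrightarrow> b \<in> A \<Longrightarrow> \<pi> a \<prec> \<pi> b \<longleftrightarrow> a \<prec> b"
  using \<pi> unfolding order_automorphisms_def by blast+

lemma automorphism_surj: "b \<in> A \<Longrightarrow> \<exists>a\<in>A. b = \<pi> a"
  using permutes_image[OF automorphism_permutes] by blast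

lemma automorphism_in_image: "\<pi> a \<in> \<pi> ` X \<longleftrightarrow> a \<in> X"
  using permutes_inj[OF automorphism_permutes] by (simp add: inj_image_mem_iff)

lemma same_cut_image: "E \<subseteq> A \<Longrightarrow> a \<in> A \<Longrightarrow> b \<in> A \<Longrightarrow> same_cut (\<pi> ` E) (\<pi> a) (\<pi> b) \<longleftrightarrow> same_cut E a b"
  unfolding same_cut_def by (simp add: automorphism_less subset_iff)

lemma determined_image:
  assumes "E \<subseteq> A" "determined E X"
  shows "determined (\<pi> ` E) (\<pi> ` X)"
  unfolding determined_def
proof (intro ballI impI)
  fix a' b' assume "a' \<in> A" "b' \<in> A" and s: "same_cut (\<pi> ` E) a' b'"
  then obtain a b where ab: "a \<in> A" "b \<in> A" "a' = \<pi> a" "b' = \<pi> b" using automorphism_surj by meson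
  then show "a' \<in> \<pi> ` X \<longleftrightarrow> b' \<in> \<pi> ` X"
    using s same_cut_image[OF assms(1)] assms(2) automorphism_in_image unfolding determined_def by simp
qed

text \<open>
  Each quantifier in the definition of \<open>bd\<close> is moved along the automorphism, which is a bijection of \<open>A\<close>.
\<close>
lemma bd_image: "bd (\<pi> ` X) = \<pi> ` bd X"
proof -
  have iff: "\<pi> a \<in> bd (\<pi> ` X) \<longleftrightarrow> a \<in> bd X" if a: "a \<in> A" for a
  proof -
    have all: "(\<forall>l. Q l) \<longleftrightarrow> (\<forall>l\<in>A. Q (\<pi> l))" if "\<And>l. l \<notin> A \<Longrightarrow> Q l" for Q
      using that automorphism_surj by metis
    have ex: "(\<exists>l. Q l) \<longleftrightarrow> (\<exists>l\<in>A. Q (\<pi> l))" if "\<And>l. Q l \<Longrightarrow> l \<in> A" for Q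
      using that automorphism_surj by metis
    have "\<pi> a \<in> bd (\<pi> ` X) \<longleftrightarrow> (\<forall>l r. l \<prec> \<pi> a \<longrightarrow> \<pi> a \<prec> r \<longrightarrow>
        (\<exists>c. l \<prec> c \<and> c \<prec> r \<and> (c \<in> \<pi> ` X \<longleftrightarrow> \<pi> a \<notin> \<pi> ` X)))"
      using a permutes_in_image[OF automorphism_permutes] unfolding bd_def by simp
    also have "\<dots> \<longleftrightarrow> (\<forall>l\<in>A. \<forall>r\<in>A. \<pi> l \<prec> \<pi> a \<longrightarrow> \<pi> a \<prec> \<pi> r \<longrightarrow>
        (\<exists>c\<in>A. \<pi> l \<prec> \<pi> c \<and> \<pi> c \<prec> \<pi> r \<and> (\<pi> c \<in> \<pi> ` X \<longleftrightarrow> \<pi> a \<notin> \<pi> ` X)))"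
      by (subst all, (use less_in in blast), subst all, (use less_in in blast), subst ex) (use less_in in blast)+
    also have "\<dots> \<longleftrightarrow> (\<forall>l\<in>A. \<forall>r\<in>A. l \<prec> a \<longrightarrow> a \<prec> r \<longrightarrow>
        (\<exists>c\<in>A. l \<prec> c \<and> c \<prec> r \<and> (c \<in> X \<longleftrightarrow> a \<notin> X)))"
      using a by (simp add: automorphism_less automorphism_in_image)
    also have "\<dots> \<longleftrightarrow> a \<in> bd X" using a less_in unfolding bd_def by blast
    finally show ?thesis .
  qed
  then show ?thesis
    using bd_subset_A automorphism_surj by (auto simp: image_iff) (metis subsetD)+
qed

lemma rank_image: "F \<subseteq> A \<Longrightarrow> a \<in> A \<Longrightarrow> rank (\<pi> ` F) (\<pi> a) = rank F a"
proof -
  assume "F \<subseteq> A" "a \<in> A"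
  then have "{b \<in> \<pi> ` F. b \<prec> \<pi> a} = \<pi> ` {b\<in>F. b \<prec> a}" using automorphism_less by auto
  moreover have "inj_on \<pi> B" for B using permutes_inj_on[OF automorphism_permutes] .
  ultimately show ?thesis unfolding rank_def by (simp add: card_image)
qed

lemma cut_type_image: "F \<subseteq> A \<Longrightarrow> a \<in> A \<Longrightarrow> cut_type (\<pi> ` F) (\<pi> a) = cut_type F a"
  unfolding cut_type_def by (simp add: rank_image automorphism_in_image)

text \<open>
  Boundaries, ranks and names of classes are defined from the order, so they are transported by
  automorphisms; the parameters have to be fixed, because \<open>P\<close> is the same on both sides.
\<close>
lemma encode_equivariant:
  assumes P: "finite P" "P \<subseteq> A" "10 \<le> card P" "\<And>p. p \<in> P \<Longrightarrow> \<pi> p = p"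
    and X: "finite E" "E \<subseteq> A" "determined E X" "X \<subseteq> A"
  shows "encode P (\<pi> ` X) = map \<pi> (encode P X)"
proof -
  define F where "F = P \<union> bd X"
  note base = finite_encode_base[OF P(1-3) X(1-3), folded F_def]
    and perm = encode_permutation[OF P(1-3) X(1-3), folded F_def]
  have imE: "finite (\<pi> ` E)" "\<pi> ` E \<subseteq> A" "determined (\<pi> ` E) (\<pi> ` X)"
    using X determined_image permutes_in_image[OF automorphism_permutes] by auto
  have "\<pi> ` P = P" using P(4) by simp
  then have piF: "\<pi> ` F = P \<union> bd (\<pi> ` X)" by (simp add: F_def bd_image image_Un)
  note perm' = encode_permutation[OF P(1-3) imE, folded piF]
  have card: "card (\<pi> ` F) = card F" using permutes_inj_on[OF automorphism_permutes] card_image by blast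
  have types: "cut_type (\<pi> ` F) ` \<pi> ` X = cut_type F ` X"
    unfolding image_image using cut_type_image base X by (intro image_cong) auto
  have "map (rank (\<pi> ` F)) (map \<pi> (encode P X)) = map (rank F) (encode P X)"
    using rank_image base perm(2) by auto
  also have "\<dots> = map (rank (\<pi> ` F)) (encode P (\<pi> ` X))"
    using perm(3) perm'(3) card types by simp
  finally have eq: "map (rank (\<pi> ` F)) (map \<pi> (encode P X)) = map (rank (\<pi> ` F)) (encode P (\<pi> ` X))" .
  have "inj_on (rank (\<pi> ` F)) (\<pi> ` F)"
    using bij_betw_rank[of "\<pi> ` F"] base permutes_image[OF automorphism_permutes]
    by (metis bij_betw_imp_inj_on finite_imageI image_mono)
  then have "map \<pi> (encode P X) = encode P (\<pi> ` X)"
    using perm(2) perm'(2) by (intro map_inj_on[OF eq]) (simp add: inj_on_def)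
  then show ?thesis ..
qed

end

end

section \<open>Sets and the automorphisms of the universe\<close>

definition small :: "'v::zfa_choice set \<Rightarrow> bool"
  where "small X \<longleftrightarrow> (\<exists>s. \<not> is_atom s \<and> elts s = X)"

lemma elts_ext: "\<not> is_atom x \<Longrightarrow> \<not> is_atom y \<Longrightarrow> elts x = elts y \<Longrightarrow> x = y"
  using ax_extensionality unfolding elts_def by blast

lemma elts_atom: "is_atom a \<Longrightarrow> elts a = {}"
  using ax_atom_no_element unfolding elts_def by blast

lemma vset_elts: "\<not> is_atom x \<Longrightarrow> vset (elts x) = x"
  unfolding vset_def by (rule the_equality) (simp, metis elts_ext)

lemma elts_vset: "small X \<Longrightarrow> elts (vset X) = X"
  and not_is_atom_vset: "small X \<Longrightarrow> \<not> is_atom (vset X)"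
  unfolding small_def using vset_elts by metis+

lemma vset_eq_iff: "small X \<Longrightarrow> small Y \<Longrightarrow> vset X = vset Y \<longleftrightarrow> X = Y"
  using elts_vset by metis

lemma small_elts: "small (elts x)"
  using ax_separation[of x "\<lambda>_. True"] unfolding small_def elts_def by auto

lemma small_subset: "small X \<Longrightarrow> Y \<subseteq> X \<Longrightarrow> small Y"
proof -
  assume "small X" "Y \<subseteq> X"
  moreover from this obtain s where "elts s = X" unfolding small_def by blast
  ultimately show ?thesis
    using ax_separation[of s "\<lambda>z. z \<in> Y"] unfolding small_def elts_def by auto
qed

lemma small_image: "small X \<Longrightarrow> small ((f :: 'v::zfa_choice \<Rightarrow> 'v) ` X)"
proof -
  assume "small X"
  then obtain s where "elts s = X" unfolding small_def by blast
  then show ?thesis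
    using ax_replacement[of s f] unfolding small_def elts_def by (simp add: set_eq_iff image_iff) blast
qed

lemma small_UN_elts: "small X \<Longrightarrow> small (\<Union>x\<in>X. elts x)"
proof -
  assume "small X"
  then obtain s where "elts s = X" unfolding small_def by blast
  then show ?thesis
    using ax_union[of s] unfolding small_def elts_def by (simp add: set_eq_iff) blast
qed

lemma small_pair: "small {x, y}"
  using ax_pairing[of x y] unfolding small_def elts_def by auto

lemma small_empty: "small {}"
  using ax_empty_set unfolding small_def elts_def by auto

lemma small_Un: "small X \<Longrightarrow> small Y \<Longrightarrow> small (X \<union> Y)"
  using small_UN_elts[OF small_pair[of "vset X" "vset Y"]] by (simp add: elts_vset)

lemma small_insert: "small X \<Longrightarrow> small (insert x X)"
  using small_Un[OF small_pair[of x x], of X] by simp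

lemma small_Pow: "small X \<Longrightarrow> small (vset ` Pow X)"
proof -
  assume X: "small X"
  then obtain s where s: "elts s = X" unfolding small_def by blast
  obtain p where p: "\<not> is_atom p" "\<And>y. y \<in>\<^sub>v p \<longleftrightarrow> \<not> is_atom y \<and> elts y \<subseteq> elts s"
    using ax_power_set[of s] unfolding elts_def by (auto simp: subset_iff)
  have "elts p = vset ` Pow X"
  proof
    show "elts p \<subseteq> vset ` Pow X"
    proof
      fix y assume "y \<in> elts p"
      then have "\<not> is_atom y" "elts y \<subseteq> X" using p(2) s unfolding elts_def by auto
      then show "y \<in> vset ` Pow X" using vset_elts by (metis PowI image_eqI)
    qed
    show "vset ` Pow X \<subseteq> elts p"
    proof
      fix y assume "y \<in> vset ` Pow X"
      then obtain Y where Y: "Y \<subseteq> X" "y = vset Y" by blast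
      then have "\<not> is_atom y \<and> elts y \<subseteq> elts s"
        using small_subset[OF X Y(1)] not_is_atom_vset elts_vset s by auto
      then show "y \<in> elts p" using p(2) unfolding elts_def by blast
    qed
  qed
  then show ?thesis using p(1) unfolding small_def by blast
qed

lemma small_atoms: "small atoms"
  using ax_set_of_atoms unfolding small_def elts_def atoms_def by auto

lemma mem_irrefl: "x \<notin> elts x"
proof -
  have "elts (vset {x}) = {x}" using elts_vset[OF small_pair[of x x]] by simp
  then have "y \<in>\<^sub>v vset {x} \<longleftrightarrow> y = x" for y unfolding elts_def by blast
  then show ?thesis using ax_foundation[of "vset {x}"] unfolding elts_def by auto
qed

lemma vnat_Suc:
  "elts (vnat (Suc n)) = insert (vnat n) (elts (vnat n))" "\<not> is_atom (vnat (Suc n))"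
  by (simp_all add: elts_vset[OF small_insert[OF small_elts]] not_is_atom_vset[OF small_insert[OF small_elts]])

lemma not_is_atom_vnat: "\<not> is_atom (vnat n)"
  by (cases n) (simp_all add: not_is_atom_vset small_empty vnat_Suc del: vnat.simps(2))

lemma elts_vnat: "elts (vnat n) = vnat ` {..<n}"
  by (induction n) (simp_all add: elts_vset small_empty vnat_Suc lessThan_Suc del: vnat.simps(2))

text \<open>
  Well-foundedness of \<open>\<in>\<close> for arbitrary classes will be derived from this fact, so its proof can
  only appeal to the axiom of foundation for sets, in the form of \<open>mem_irrefl\<close>.
\<close>
lemma inj_vnat: "inj vnat"
proof (rule linorder_injI)
  fix i j :: nat assume "i < j"
  then have "vnat i \<in> elts (vnat j)" by (simp add: elts_vnat)
  then show "vnat i \<noteq> (vnat j :: 'a)" using mem_irrefl by metis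
qed

lemma small_range_vnat: "small (range (vnat :: nat \<Rightarrow> 'v::zfa_choice))"
proof -
  obtain w e :: 'v where e: "e \<in>\<^sub>v w" "\<not> is_atom e" "elts e = {}"
    and step: "\<And>x. x \<in>\<^sub>v w \<Longrightarrow> \<exists>y. y \<in>\<^sub>v w \<and> elts y = insert x (elts x)"
    using ax_infinity unfolding elts_def by (simp add: set_eq_iff disj_commute) blast
  have "vnat n \<in>\<^sub>v w" for n
  proof (induction n)
    case 0
    have "e = vnat 0" using e elts_ext not_is_atom_vnat[of 0] elts_vnat[of 0] by (metis image_empty lessThan_0)
    then show ?case using e by simp
  next
    case (Suc n)
    then obtain y where y: "y \<in>\<^sub>v w" "elts y = insert (vnat n) (elts (vnat n))" using step by blast
    then have "y = vnat (Suc n)"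
      using elts_atom by (intro elts_ext) (auto simp: not_is_atom_vnat elts_vnat lessThan_Suc simp del: vnat.simps)
    then show ?case using y by simp
  qed
  then have "range vnat \<subseteq> elts w" unfolding elts_def by blast
  then show ?thesis using small_subset small_elts by blast
qed

text \<open>
  Replacement is available for every function of the metalogic, so the set of natural numbers,
  which is given by infinity, can be mapped onto any countable collection.
\<close>
lemma small_countable:
  fixes X :: "'v::zfa_choice set"
  assumes "countable X" shows "small X"
proof (cases "X = {}")
  case False
  have "X = (\<lambda>x. from_nat_into X (inv vnat x)) ` range vnat"
    using range_from_nat_into[OF False assms] by (simp add: image_image inv_f_f[OF inj_vnat])
  then show ?thesis using small_image[OF small_range_vnat] by metis
qed (simp add: small_empty)

lemma small_finite: "finite X \<Longrightarrow> small X"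
  using small_countable countable_finite by blast

text \<open>
  Foundation speaks of sets only. It extends to classes because the part of a class below a given
  \<open>x\<close> in the transitive closure of \<open>x\<close> is a set.
\<close>
lemma wf_mem: "wf {(y, x :: 'v::zfa_choice). y \<in>\<^sub>v x}"
proof (rule wfI_min)
  fix x :: 'v and Q assume x: "x \<in> Q"
  define t where "t = rec_nat x (\<lambda>_ y. vset (\<Union>z\<in>elts y. elts z))"
  define T where "T = (\<Union>y\<in>range t. elts y)"
  have t: "t 0 = x" "elts (t (Suc n)) = (\<Union>z\<in>elts (t n). elts z)" for n
    unfolding t_def using elts_vset[OF small_UN_elts[OF small_elts]] by auto
  have T: "elts x \<subseteq> T" "\<And>y. y \<in> T \<Longrightarrow> elts y \<subseteq> T"
  proof -
    show "elts x \<subseteq> T" unfolding T_def using t(1) by blast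
    fix y assume "y \<in> T"
    then obtain n where "y \<in> elts (t n)" unfolding T_def by blast
    then have "elts y \<subseteq> elts (t (Suc n))" using t(2) by blast
    then show "elts y \<subseteq> T" unfolding T_def by blast
  qed
  show "\<exists>z\<in>Q. \<forall>y. (y, z) \<in> {(y, x). y \<in>\<^sub>v x} \<longrightarrow> y \<notin> Q"
  proof (cases "T \<inter> Q = {}")
    case True
    then show ?thesis using x T(1) unfolding elts_def by blast
  next
    case False
    have "small T" unfolding T_def by (intro small_UN_elts small_countable) auto
    then have "elts (vset (T \<inter> Q)) = T \<inter> Q" using elts_vset small_subset by (metis inf_le1)
    then obtain y where "y \<in> T \<inter> Q" "\<forall>z. z \<in>\<^sub>v y \<longrightarrow> z \<notin> T \<inter> Q"
      using ax_foundation[of "vset (T \<inter> Q)"] False unfolding elts_def by blast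
    then show ?thesis using T(2) unfolding elts_def by blast
  qed
qed

lemma mem_induct:
  assumes "\<And>x. (\<And>y. y \<in> elts x \<Longrightarrow> P y) \<Longrightarrow> P (x :: 'v::zfa_choice)"
  shows "P x"
  using wf_mem by (induction x rule: wf_induct_rule) (use assms in \<open>auto simp: elts_def\<close>)

lemma vpair_eq_iff: "vpair a b = vpair c d \<longleftrightarrow> a = c \<and> b = d"
proof -
  have "vset {x} = vset {u, v} \<longleftrightarrow> x = u \<and> x = v" "vset {u, v} = vset {x} \<longleftrightarrow> x = u \<and> x = v" for x u v :: 'a
    using vset_eq_iff[OF small_pair[of x x] small_pair[of u v]]
      vset_eq_iff[OF small_pair[of u v] small_pair[of x x]] by auto
  then show ?thesis
    unfolding vpair_def
    by (simp add: vset_eq_iff[OF small_pair small_pair] doubleton_eq_iff del: insert_absorb2)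
      (use vset_eq_iff[OF small_pair[of a a] small_pair[of c c]] in auto)
qed

subsection \<open>Extending permutations of the atoms\<close>

text \<open>
  An explicit solution of the specification of \<open>extend\<close>, by \<open>\<in>\<close>-recursion.
\<close>
definition lift :: "('v::zfa_choice \<Rightarrow> 'v) \<Rightarrow> 'v \<Rightarrow> 'v"
  where "lift \<pi> = wfrec {(y, x). y \<in>\<^sub>v x} (\<lambda>\<phi> x. if is_atom x then \<pi> x else vset (\<phi> ` elts x))"

lemma lift_atom: "is_atom a \<Longrightarrow> lift \<pi> a = \<pi> a"
  unfolding lift_def by (simp add: wfrec[OF wf_mem])

lemma lift_set: "\<not> is_atom x \<Longrightarrow> lift \<pi> x = vset (lift \<pi> ` elts x)"
proof -
  assume x: "\<not> is_atom x"
  have "lift \<pi> x = vset (cut (lift \<pi>) {(y, x). y \<in>\<^sub>v x} x ` elts x)"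
    unfolding lift_def by (subst wfrec[OF wf_mem]) (simp add: x)
  also have "cut (lift \<pi>) {(y, x). y \<in>\<^sub>v x} x ` elts x = lift \<pi> ` elts x"
    by (intro image_cong) (auto simp: cut_apply elts_def)
  finally show ?thesis .
qed

lemma mem_automorphism_elts: "mem_automorphism \<phi> \<Longrightarrow> elts (\<phi> x) = \<phi> ` elts x"
proof -
  assume \<phi>: "mem_automorphism \<phi>"
  then have "surj \<phi>" "\<And>y z. \<phi> y \<in>\<^sub>v \<phi> z \<longleftrightarrow> y \<in>\<^sub>v z"
    unfolding mem_automorphism_def by (auto simp: bij_is_surj)
  then show ?thesis unfolding elts_def by (auto simp: image_iff) (metis surjD)
qed

lemma mem_automorphism_unique:
  assumes "mem_automorphism \<phi>" "mem_automorphism \<psi>" "\<And>a. a \<in> atoms \<Longrightarrow> \<phi> a = \<psi> a"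
  shows "\<phi> = \<psi>"
proof
  fix x show "\<phi> x = \<psi> x"
  proof (induction x rule: mem_induct)
    case (1 x)
    show ?case
    proof (cases "is_atom x")
      case False
      then have "\<not> is_atom (\<phi> x)" "\<not> is_atom (\<psi> x)" using assms unfolding mem_automorphism_def by auto
      moreover have "\<phi> ` elts x = \<psi> ` elts x" using 1 by (intro image_cong) auto
      ultimately show ?thesis using elts_ext assms(1,2) mem_automorphism_elts by metis
    qed (use assms(3) in \<open>simp add: atoms_def\<close>)
  qed
qed

context
  fixes \<pi> :: "'v::zfa_choice \<Rightarrow> 'v"
  assumes \<pi>: "\<pi> permutes atoms"
begin

lemma is_atom_lift: "is_atom (lift \<pi> x) \<longleftrightarrow> is_atom x"
proof (cases "is_atom x")
  case True
  then show ?thesis using permutes_in_image[OF \<pi>, of x] by (simp add: lift_atom atoms_def)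
next
  case False
  then show ?thesis using not_is_atom_vset[OF small_image[OF small_elts]] by (simp add: lift_set)
qed

lemma elts_lift: "elts (lift \<pi> x) = lift \<pi> ` elts x"
  by (cases "is_atom x")
    (simp_all add: is_atom_lift elts_atom lift_set elts_vset small_image small_elts)

end

lemma lift_lift_inv:
  assumes \<pi>: "\<pi> permutes atoms"
  shows "lift (inv \<pi>) (lift \<pi> x) = x"
proof (induction x rule: mem_induct)
  case (1 x)
  show ?case
  proof (cases "is_atom x")
    case True
    then have "is_atom (\<pi> x)" using is_atom_lift[OF \<pi>, of x] by (simp add: lift_atom)
    then show ?thesis using True by (simp add: lift_atom permutes_inverses(2)[OF \<pi>])
  next
    case False
    have "lift (inv \<pi>) ` elts (lift \<pi> x) = (\<lambda>y. y) ` elts x"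
      unfolding elts_lift[OF \<pi>] image_image using 1 by (intro image_cong) auto
    then show ?thesis
      using False by (simp add: lift_set[of "lift \<pi> x"] is_atom_lift[OF \<pi>] vset_elts)
  qed
qed

lemma mem_automorphism_lift:
  assumes \<pi>: "\<pi> permutes atoms"
  shows "mem_automorphism (lift \<pi>)"
proof -
  have "lift \<pi> (lift (inv \<pi>) x) = x" for x
    using lift_lift_inv[OF permutes_inv[OF \<pi>]] by (simp add: permutes_inv_inv[OF \<pi>])
  then have bij: "bij (lift \<pi>)"
    using lift_lift_inv[OF \<pi>] by (intro o_bij[of "lift (inv \<pi>)"]) (auto simp: fun_eq_iff)
  have "lift \<pi> x \<in>\<^sub>v lift \<pi> y \<longleftrightarrow> x \<in>\<^sub>v y" for x y
  proof -
    have "lift \<pi> x \<in> elts (lift \<pi> y) \<longleftrightarrow> x \<in> elts y"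
      unfolding elts_lift[OF \<pi>] using bij_is_inj[OF bij] by (simp add: inj_image_mem_iff)
    then show ?thesis by (simp add: elts_def)
  qed
  then show ?thesis unfolding mem_automorphism_def using bij is_atom_lift[OF \<pi>] by blast
qed

text \<open>
  This justifies the definite description in \<open>extend\<close>.
\<close>
lemma extend_eq_lift:
  assumes \<pi>: "\<pi> permutes atoms"
  shows "extend \<pi> = lift \<pi>"
  unfolding extend_def
proof (rule the_equality)
  show *: "mem_automorphism (lift \<pi>) \<and> (\<forall>a\<in>atoms. lift \<pi> a = \<pi> a)"
    using mem_automorphism_lift[OF \<pi>] by (simp add: lift_atom atoms_def)
  fix \<phi> assume "mem_automorphism \<phi> \<and> (\<forall>a\<in>atoms. \<phi> a = \<pi> a)"
  then show "\<phi> = lift \<pi>" using * by (intro mem_automorphism_unique) auto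
qed

context
  fixes \<pi> :: "'v::zfa_choice \<Rightarrow> 'v"
  assumes \<pi>: "\<pi> permutes atoms"
begin

lemma extend_atom: "a \<in> atoms \<Longrightarrow> extend \<pi> a = \<pi> a"
  by (simp add: extend_eq_lift[OF \<pi>] lift_atom atoms_def)

lemma elts_extend: "elts (extend \<pi> x) = extend \<pi> ` elts x"
  by (simp add: extend_eq_lift[OF \<pi>] elts_lift[OF \<pi>])

lemma is_atom_extend: "is_atom (extend \<pi> x) \<longleftrightarrow> is_atom x"
  by (simp add: extend_eq_lift[OF \<pi>] is_atom_lift[OF \<pi>])

lemma extend_inv_extend: "extend (inv \<pi>) (extend \<pi> x) = x"
  using lift_lift_inv[OF \<pi>] by (simp add: extend_eq_lift[OF \<pi>] extend_eq_lift[OF permutes_inv[OF \<pi>]])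

lemma extend_vset: "small X \<Longrightarrow> extend \<pi> (vset X) = vset (extend \<pi> ` X)"
  by (rule elts_ext) (simp_all add: is_atom_extend elts_extend elts_vset not_is_atom_vset small_image)

lemma extend_vset_atoms: "X \<subseteq> atoms \<Longrightarrow> extend \<pi> (vset X) = vset (\<pi> ` X)"
proof -
  assume X: "X \<subseteq> atoms"
  then have "extend \<pi> ` X = \<pi> ` X" using extend_atom by (intro image_cong) auto
  then show ?thesis using extend_vset[OF small_subset[OF small_atoms X]] by simp
qed

lemma extend_vpair: "extend \<pi> (vpair a b) = vpair (extend \<pi> a) (extend \<pi> b)"
proof -
  have "extend \<pi> (vset {x, y}) = vset {extend \<pi> x, extend \<pi> y}" for x y
    by (simp add: extend_vset small_pair)
  from this[of "vset {a}" "vset {a, b}"] this[of a a] this[of a b]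
  show ?thesis unfolding vpair_def by simp
qed

lemma extend_vnat: "extend \<pi> (vnat n) = vnat n"
proof (induction n rule: less_induct)
  case (less n)
  then have "extend \<pi> ` elts (vnat n) = elts (vnat n)" by (force simp: elts_vnat image_image)
  then show ?case by (intro elts_ext) (simp_all add: is_atom_extend not_is_atom_vnat elts_extend)
qed

end

definition vgraph :: "'v::zfa_choice \<Rightarrow> ('v \<Rightarrow> 'v) \<Rightarrow> 'v"
  where "vgraph x h = vset ((\<lambda>a. vpair a (h a)) ` elts x)"

lemma elts_vgraph: "elts (vgraph x h) = (\<lambda>a. vpair a (h a)) ` elts x"
  unfolding vgraph_def by (simp add: elts_vset small_image small_elts)

lemma vpair_mem_vgraph: "vpair a b \<in>\<^sub>v vgraph x h \<longleftrightarrow> a \<in> elts x \<and> b = h a"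
proof -
  have "vpair a b \<in>\<^sub>v vgraph x h \<longleftrightarrow> vpair a b \<in> elts (vgraph x h)" by (simp add: elts_def)
  then show ?thesis by (auto simp: elts_vgraph vpair_eq_iff)
qed

lemma vfunction_vgraph: "h ` elts x \<subseteq> elts y \<Longrightarrow> vfunction (vgraph x h) x y"
proof -
  have "\<not> is_atom (vgraph x h)"
    unfolding vgraph_def by (intro not_is_atom_vset small_image small_elts)
  then show "h ` elts x \<subseteq> elts y \<Longrightarrow> vfunction (vgraph x h) x y"
    unfolding vfunction_def by (auto simp: vpair_mem_vgraph elts_vgraph)
qed

lemma vinjection_vgraph: "h ` elts x \<subseteq> elts y \<Longrightarrow> inj_on h (elts x) \<Longrightarrow> vinjection (vgraph x h) x y"
  unfolding vinjection_def using vfunction_vgraph by (auto simp: vpair_mem_vgraph inj_on_def)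

lemma vbijection_vgraph: "bij_betw h (elts x) (elts y) \<Longrightarrow> vbijection (vgraph x h) x y"
  unfolding vbijection_def bij_betw_def using vinjection_vgraph[of h x y]
  by (auto simp: vpair_mem_vgraph)

section \<open>Permutation models and supports\<close>

definition supports :: "('v::zfa_choice \<Rightarrow> 'v) set \<Rightarrow> 'v set \<Rightarrow> 'v \<Rightarrow> bool"
  where "supports G E x \<longleftrightarrow> (\<forall>\<pi>\<in>fix_group G E. extend \<pi> x = x)"

lemma symmetric_iff: "symmetric G x \<longleftrightarrow> (\<exists>E. E \<subseteq> atoms \<and> finite E \<and> supports G E x)"
  unfolding symmetric_def supports_def sym_group_def fix_group_def by blast

lemma supports_mono: "supports G E x \<Longrightarrow> E \<subseteq> F \<Longrightarrow> supports G F x"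
  unfolding supports_def fix_group_def by blast

lemma in_permutation_model_iff:
  "x \<in> permutation_model G \<longleftrightarrow>
     (\<exists>E. E \<subseteq> atoms \<and> finite E \<and> supports G E x) \<and> elts x \<subseteq> permutation_model G"
  unfolding symmetric_iff[symmetric] elts_def by (subst permutation_model.simps) blast

locale atom_group =
  fixes G :: "('v::zfa_choice \<Rightarrow> 'v) set"
  assumes permutes_atoms: "\<pi> \<in> G \<Longrightarrow> \<pi> permutes atoms"
    and inv_closed: "\<pi> \<in> G \<Longrightarrow> inv \<pi> \<in> G"
begin

abbreviation M :: "'v set" where "M \<equiv> permutation_model G"

lemma fix_group_permutes: "\<pi> \<in> fix_group G E \<Longrightarrow> \<pi> permutes atoms"
  unfolding fix_group_def using permutes_atoms by blast

lemma fix_group_inv: "\<pi> \<in> fix_group G E \<Longrightarrow> inv \<pi> \<in> fix_group G E"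
  unfolding fix_group_def using inv_closed permutes_inv_eq[OF permutes_atoms] by auto

text \<open>
  Closure under the group yields invariance because the group contains inverses.
\<close>
lemma supports_vset:
  assumes X: "small X" and inv: "\<And>\<pi> x. \<pi> \<in> fix_group G E \<Longrightarrow> x \<in> X \<Longrightarrow> extend \<pi> x \<in> X"
  shows "supports G E (vset X)"
  unfolding supports_def
proof
  fix \<pi> assume \<pi>: "\<pi> \<in> fix_group G E"
  note perm = fix_group_permutes[OF \<pi>]
  have "X \<subseteq> extend \<pi> ` X"
  proof
    fix x assume "x \<in> X"
    then have "extend (inv \<pi>) x \<in> X" using inv fix_group_inv[OF \<pi>] by blast
    moreover have "extend \<pi> (extend (inv \<pi>) x) = x"
      using extend_inv_extend[OF permutes_inv[OF perm]] by (simp add: permutes_inv_inv[OF perm])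
    ultimately show "x \<in> extend \<pi> ` X" by (metis image_eqI)
  qed
  then have "extend \<pi> ` X = X" using inv[OF \<pi>] by blast
  then show "extend \<pi> (vset X) = vset X" by (simp add: extend_vset[OF perm X])
qed

lemma vset_in_model:
  assumes "small X" "X \<subseteq> M" "E \<subseteq> atoms" "finite E"
    and "\<And>\<pi> x. \<pi> \<in> fix_group G E \<Longrightarrow> x \<in> X \<Longrightarrow> extend \<pi> x \<in> X"
  shows "vset X \<in> M"
  using assms supports_vset[OF assms(1,5)]
  by (subst in_permutation_model_iff) (auto simp: elts_vset)

lemma supports_mem:
  assumes "supports G E x" "\<pi> \<in> fix_group G E" "y \<in> elts x"
  shows "extend \<pi> y \<in> elts x"
  using elts_extend[OF fix_group_permutes[OF assms(2)], of x] assms unfolding supports_def by auto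

lemma atom_in_model: "a \<in> atoms \<Longrightarrow> a \<in> M"
proof (subst in_permutation_model_iff, intro conjI exI[of _ "{a}"])
  assume a: "a \<in> atoms"
  then show "supports G {a} a"
    unfolding supports_def using extend_atom[OF permutes_atoms] by (auto simp: fix_group_def)
  show "elts a \<subseteq> M" using a by (simp add: atoms_def elts_atom)
qed auto

lemma pair_in_model: "a \<in> M \<Longrightarrow> b \<in> M \<Longrightarrow> vset {a, b} \<in> M"
proof -
  assume a: "a \<in> M" and b: "b \<in> M"
  obtain E F where "E \<subseteq> atoms" "finite E" "supports G E a" "F \<subseteq> atoms" "finite F" "supports G F b"
    using a b in_permutation_model_iff by metis
  then show ?thesis
    using a b supports_mono[of G E a "E \<union> F"] supports_mono[of G F b "E \<union> F"]
    by (intro vset_in_model[OF small_pair, where E = "E \<union> F"]) (auto simp: supports_def)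
qed

lemma vpair_in_model: "a \<in> M \<Longrightarrow> b \<in> M \<Longrightarrow> vpair a b \<in> M"
  unfolding vpair_def using pair_in_model[of a a] pair_in_model[of a b] pair_in_model by simp

lemma vnat_in_model: "vnat n \<in> M"
proof (induction n rule: less_induct)
  case (less n)
  have "supports G {} (vnat n)" unfolding supports_def using extend_vnat fix_group_permutes by blast
  then show ?case using less by (subst in_permutation_model_iff) (auto simp: elts_vnat)
qed

text \<open>
  A function of the metalogic between sets of the model belongs to the model as soon as it commutes
  with all permutations that fix some finite set. All injections that the
  theorem asserts are obtained in this way.
\<close>
lemma vgraph_in_model:
  assumes x: "x \<in> M" and E: "E \<subseteq> atoms" "finite E" "supports G E x"
    and h: "h ` elts x \<subseteq> M"
      "\<And>\<pi> a. \<pi> \<in> fix_group G E \<Longrightarrow> a \<in> elts x \<Longrightarrow> h (extend \<pi> a) = extend \<pi> (h a)"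
  shows "vgraph x h \<in> M"
  unfolding vgraph_def
proof (rule vset_in_model[OF _ _ E(1,2)])
  show "small ((\<lambda>a. vpair a (h a)) ` elts x)" by (intro small_image small_elts)
  show "(\<lambda>a. vpair a (h a)) ` elts x \<subseteq> M"
    using x h(1) vpair_in_model in_permutation_model_iff[of x G] by blast
  fix \<pi> p assume \<pi>: "\<pi> \<in> fix_group G E" and "p \<in> (\<lambda>a. vpair a (h a)) ` elts x"
  then obtain a where a: "a \<in> elts x" "p = vpair a (h a)" by blast
  then have "extend \<pi> p = vpair (extend \<pi> a) (h (extend \<pi> a))"
    using h(2)[OF \<pi>] by (simp add: extend_vpair[OF fix_group_permutes[OF \<pi>]])
  then show "extend \<pi> p \<in> (\<lambda>a. vpair a (h a)) ` elts x"
    using supports_mem[OF E(3) \<pi> a(1)] by blast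
qed

lemma in_own_cardinality:
  assumes "x \<in> M" "\<not> is_atom x"
  shows "x \<in> cardinality M x"
proof -
  obtain E where "E \<subseteq> atoms" "finite E" "supports G E x" "elts x \<subseteq> M"
    using assms in_permutation_model_iff by metis
  then have "vgraph x (\<lambda>a. a) \<in> M" using assms by (intro vgraph_in_model[of x E]) auto
  moreover have "vbijection (vgraph x (\<lambda>a. a)) x x"
    by (intro vbijection_vgraph) (simp add: bij_betw_def)
  ultimately show ?thesis unfolding cardinality_def using assms by blast
qed

lemma cardinal_leI:
  assumes "x \<in> M" "\<not> is_atom x" "y \<in> M" "\<not> is_atom y"
    and "E \<subseteq> atoms" "finite E" "supports G E x"
    and "h ` elts x \<subseteq> elts y" "inj_on h (elts x)"
    and "\<And>\<pi> a. \<pi> \<in> fix_group G E \<Longrightarrow> a \<in> elts x \<Longrightarrow> h (extend \<pi> a) = extend \<pi> (h a)"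
  shows "cardinal_le M (cardinality M x) (cardinality M y)"
proof -
  have "h ` elts x \<subseteq> M" using assms(3,8) in_permutation_model_iff[of y G] by blast
  then have "vgraph x h \<in> M" using assms by (intro vgraph_in_model[of x E]) auto
  moreover have "vinjection (vgraph x h) x y" using assms by (intro vinjection_vgraph) auto
  ultimately show ?thesis unfolding cardinal_le_def using in_own_cardinality assms(1-4) by blast
qed

text \<open>
  The tool for refuting equality of cardinals. A permutation that fixes the bijection \<open>f\<close> maps the pair
  of \<open>a\<close> and \<open>f(a)\<close> to another pair in \<open>f\<close>, so it fixes \<open>a\<close> if and only if it fixes
  \<open>f(a)\<close>. Thus \<open>f\<close> matches the elements with support \<open>E\<close> on both sides, and these can be counted.
\<close>
lemma bijection_between_supported_elements:
  assumes f: "vbijection f x y" "supports G E f"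
  shows "\<exists>g. bij_betw g {a\<in>elts x. supports G E a} {b\<in>elts y. supports G E b}"
proof -
  have func: "\<And>a. a \<in> elts x \<Longrightarrow> \<exists>!b. vpair a b \<in>\<^sub>v f"
    and inj: "\<And>a a' b. vpair a b \<in>\<^sub>v f \<Longrightarrow> vpair a' b \<in>\<^sub>v f \<Longrightarrow> a = a'"
    and surj: "\<And>b. b \<in> elts y \<Longrightarrow> \<exists>a. vpair a b \<in>\<^sub>v f"
    and dom: "\<And>p. p \<in>\<^sub>v f \<Longrightarrow> \<exists>a\<in>elts x. \<exists>b\<in>elts y. p = vpair a b"
    using f(1) unfolding vbijection_def vinjection_def vfunction_def by (auto simp: elts_def)
  have dom: "a \<in> elts x \<and> b \<in> elts y" if "vpair a b \<in>\<^sub>v f" for a b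
    using dom[OF that] by (auto simp: vpair_eq_iff)
  have inv: "vpair (extend \<pi> a) (extend \<pi> b) \<in>\<^sub>v f" if "\<pi> \<in> fix_group G E" "vpair a b \<in>\<^sub>v f" for \<pi> a b
    using supports_mem[OF f(2) that(1), of "vpair a b"] that
    by (simp add: extend_vpair[OF fix_group_permutes] elts_def)
  have supp: "supports G E a \<longleftrightarrow> supports G E b" if "vpair a b \<in>\<^sub>v f" for a b
  proof -
    have "extend \<pi> a = a \<longleftrightarrow> extend \<pi> b = b" if "\<pi> \<in> fix_group G E" for \<pi>
      using inv[OF that \<open>vpair a b \<in>\<^sub>v f\<close>] \<open>vpair a b \<in>\<^sub>v f\<close> func inj dom by metis
    then show ?thesis unfolding supports_def by blast
  qed
  define g where "g a = (THE b. vpair a b \<in>\<^sub>v f)" for a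
  have g: "vpair a (g a) \<in>\<^sub>v f" if "a \<in> elts x" for a
    unfolding g_def using theI'[OF func[OF that]] .
  have g_eq: "g a = b" if "vpair a b \<in>\<^sub>v f" for a b
    using g func dom that by metis
  have "bij_betw g {a\<in>elts x. supports G E a} {b\<in>elts y. supports G E b}"
    unfolding bij_betw_def
  proof
    show "inj_on g {a\<in>elts x. supports G E a}"
      using g inj by (intro inj_onI) (metis (mono_tags, lifting) mem_Collect_eq)
    show "g ` {a\<in>elts x. supports G E a} = {b\<in>elts y. supports G E b}"
    proof (intro equalityI subsetI)
      fix b assume "b \<in> g ` {a\<in>elts x. supports G E a}"
      then obtain a where "a \<in> elts x" "supports G E a" "b = g a" by blast
      then show "b \<in> {b\<in>elts y. supports G E b}" using g[of a] supp dom by blast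
    next
      fix b assume b: "b \<in> {b\<in>elts y. supports G E b}"
      then obtain a where a: "vpair a b \<in>\<^sub>v f" using surj by blast
      then have "a \<in> {a\<in>elts x. supports G E a}" using supp dom b by blast
      then show "b \<in> g ` {a\<in>elts x. supports G E a}" using g_eq[OF a] by blast
    qed
  qed
  then show ?thesis by blast
qed

text \<open>
  A support of the bijection can be enlarged by any finite set \<open>E0\<close>, so it is enough to count for
  large \<open>E\<close>.
\<close>
lemma cardinality_neqI:
  assumes y: "y \<in> M" "\<not> is_atom y" and E0: "finite E0" "E0 \<subseteq> atoms"
    and neq: "\<And>E. E0 \<subseteq> E \<Longrightarrow> E \<subseteq> atoms \<Longrightarrow> finite E \<Longrightarrow>
      \<nexists>g. bij_betw g {a\<in>elts x. supports G E a} {b\<in>elts y. supports G E b}"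
  shows "cardinality M x \<noteq> cardinality M y"
proof
  assume "cardinality M x = cardinality M y"
  then have "y \<in> cardinality M x" using in_own_cardinality[OF y] by simp
  then obtain f where f: "f \<in> M" "vbijection f x y" unfolding cardinality_def by blast
  then obtain E where "E \<subseteq> atoms" "finite E" "supports G E f" using in_permutation_model_iff by metis
  then have "supports G (E0 \<union> E) f" using supports_mono[of G E f "E0 \<union> E"] by blast
  then show False
    using bijection_between_supported_elements[OF f(2)] neq[of "E0 \<union> E"] E0 \<open>E \<subseteq> atoms\<close> \<open>finite E\<close> by auto
qed

end

section \<open>Finite sequences as sets\<close>

text \<open>
  A list represents a finite sequence of the universe, that is, a function whose domain is a natural
  number. By \<open>vfunction_vnat_iff\<close> every finite sequence arises in this way.
\<close>
definition vseq :: "'v::zfa_choice list \<Rightarrow> 'v"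
  where "vseq xs = vset ((\<lambda>i. vpair (vnat i) (xs ! i)) ` {..<length xs})"

lemma elts_vseq: "elts (vseq xs) = (\<lambda>i. vpair (vnat i) (xs ! i)) ` {..<length xs}"
  and not_is_atom_vseq: "\<not> is_atom (vseq xs)"
  unfolding vseq_def by (simp_all add: elts_vset not_is_atom_vset small_finite)

lemma vpair_mem_vseq: "vpair a b \<in>\<^sub>v vseq xs \<longleftrightarrow> (\<exists>i<length xs. a = vnat i \<and> b = xs ! i)"
proof -
  have "vpair a b \<in>\<^sub>v vseq xs \<longleftrightarrow> vpair a b \<in> elts (vseq xs)" by (simp add: elts_def)
  then show ?thesis by (auto simp: elts_vseq vpair_eq_iff)
qed

lemma vnat_eq_iff: "vnat i = vnat j \<longleftrightarrow> i = j"
  using inj_vnat by (rule inj_eq)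

lemma vpair_vnat_mem_vseq: "vpair (vnat i) b \<in>\<^sub>v vseq xs \<longleftrightarrow> i < length xs \<and> b = xs ! i"
  unfolding vpair_mem_vseq vnat_eq_iff by auto

lemma inj_vseq: "inj vseq"
proof (rule injI)
  fix xs ys :: "'a list" assume eq: "vseq xs = vseq ys"
  have *: "i < length xs \<and> b = xs ! i \<longleftrightarrow> i < length ys \<and> b = ys ! i" for i b
    using eq vpair_vnat_mem_vseq by metis
  then have len: "i < length xs \<longleftrightarrow> i < length ys" for i by blast
  have "length xs = length ys" using len[of "length xs"] len[of "length ys"] by linarith
  then show "xs = ys" using * by (intro nth_equalityI) auto
qed

lemma vfunction_vnat_iff:
  "vfunction s (vnat n) x \<longleftrightarrow> (\<exists>xs. length xs = n \<and> set xs \<subseteq> elts x \<and> s = vseq xs)"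
proof
  assume s: "vfunction s (vnat n) x"
  define xs where "xs = map (\<lambda>i. THE b. vpair (vnat i) b \<in>\<^sub>v s) [0..<n]"
  have ex1: "\<exists>!b. vpair (vnat i) b \<in>\<^sub>v s" if "i < n" for i
    using s that unfolding vfunction_def by (auto simp: elts_vnat)
  have nth: "vpair (vnat i) (xs ! i) \<in>\<^sub>v s" if "i < n" for i
    using theI'[OF ex1[OF that]] that unfolding xs_def by simp
  have len: "length xs = n" unfolding xs_def by simp
  have pairs: "\<exists>i<n. \<exists>b\<in>elts x. p = vpair (vnat i) b" if "p \<in>\<^sub>v s" for p
    using s that unfolding vfunction_def by (simp add: elts_vnat elts_def[of s]) blast
  have "xs ! i \<in> elts x" if "i < n" for i
    using pairs[OF nth[OF that]] by (auto simp: vpair_eq_iff)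
  then have set: "set xs \<subseteq> elts x" using len by (auto simp: set_conv_nth)
  have "p \<in> elts s \<longleftrightarrow> p \<in> elts (vseq xs)" for p
  proof
    assume "p \<in> elts s"
    then have "p \<in>\<^sub>v s" by (simp add: elts_def)
    then obtain i b where "i < n" "p = vpair (vnat i) b" "vpair (vnat i) b \<in>\<^sub>v s"
      using pairs[of p] by blast
    then show "p \<in> elts (vseq xs)" using nth ex1 len unfolding elts_vseq by blast
  next
    assume "p \<in> elts (vseq xs)"
    then obtain i where "i < n" "p = vpair (vnat i) (xs ! i)" using len unfolding elts_vseq by blast
    then show "p \<in> elts s" using nth by (simp add: elts_def)
  qed
  moreover have "\<not> is_atom s" using s unfolding vfunction_def by blast
  ultimately have "s = vseq xs" using not_is_atom_vseq by (intro elts_ext) auto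
  then show "\<exists>xs. length xs = n \<and> set xs \<subseteq> elts x \<and> s = vseq xs" using len set by blast
next
  assume "\<exists>xs. length xs = n \<and> set xs \<subseteq> elts x \<and> s = vseq xs"
  then obtain xs where xs: "length xs = n" "set xs \<subseteq> elts x" "s = vseq xs" by blast
  then have "xs ! i \<in> elts x" if "i < n" for i using that by auto
  then show "vfunction s (vnat n) x"
    unfolding vfunction_def xs(3) using xs(1)
    by (auto simp: not_is_atom_vseq elts_vseq elts_vnat vpair_vnat_mem_vseq)
qed

lemma vinjection_vnat_iff:
  "vinjection s (vnat n) x \<longleftrightarrow> (\<exists>xs. length xs = n \<and> distinct xs \<and> set xs \<subseteq> elts x \<and> s = vseq xs)"
proof -
  have "(\<forall>a a' b. vpair a b \<in>\<^sub>v vseq xs \<longrightarrow> vpair a' b \<in>\<^sub>v vseq xs \<longrightarrow> a = a') \<longleftrightarrow> distinct xs" for xs :: "'a list"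
    unfolding vpair_mem_vseq distinct_conv_nth using vnat_eq_iff by metis
  then show ?thesis unfolding vinjection_def vfunction_vnat_iff by blast
qed

lemma extend_vseq:
  assumes \<pi>: "\<pi> permutes atoms"
  shows "extend \<pi> (vseq xs) = vseq (map (extend \<pi>) xs)"
proof (rule elts_ext)
  have "extend \<pi> ` elts (vseq xs) = elts (vseq (map (extend \<pi>) xs))"
    unfolding elts_vseq image_image
    by (auto simp: extend_vpair[OF \<pi>] extend_vnat[OF \<pi>] intro!: image_cong)
  then show "elts (extend \<pi> (vseq xs)) = elts (vseq (map (extend \<pi>) xs))" by (simp add: elts_extend[OF \<pi>])
qed (simp_all add: is_atom_extend[OF \<pi>] not_is_atom_vseq)

lemma extend_vseq_atoms:
  assumes \<pi>: "\<pi> permutes atoms" and xs: "set xs \<subseteq> atoms"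
  shows "extend \<pi> (vseq xs) = vseq (map \<pi> xs)"
proof -
  have "map (extend \<pi>) xs = map \<pi> xs" using xs extend_atom[OF \<pi>] by auto
  then show ?thesis by (simp only: extend_vseq[OF \<pi>])
qed

section \<open>The ordered Mostowski model\<close>

locale mostowski = countable_dlo "atoms :: 'v::zfa_choice set" R for R

sublocale mostowski \<subseteq> atom_group "order_automorphisms atoms R"
proof
  fix \<pi> :: "'v \<Rightarrow> 'v" assume \<pi>: "\<pi> \<in> order_automorphisms atoms R"
  show perm: "\<pi> permutes atoms" by (rule automorphism_permutes[OF \<pi>])
  have "(inv \<pi> x, inv \<pi> y) \<in> R \<longleftrightarrow> (x, y) \<in> R" if "x \<in> atoms" "y \<in> atoms" for x y
    using automorphism_less[OF \<pi>, of "inv \<pi> x" "inv \<pi> y"] that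
      permutes_in_image[OF permutes_inv[OF perm]] by (simp add: permutes_inverses[OF perm])
  then show "inv \<pi> \<in> order_automorphisms atoms R"
    using permutes_inv[OF perm] unfolding order_automorphisms_def by blast
qed

context mostowski
begin

abbreviation G where "G \<equiv> order_automorphisms atoms R"

text \<open>
  The following collections of sets and lists of atoms represent the elements of the sets whose
  cardinalities are compared. Every list and every finite set of atoms has a counterpart in the model,
  but among the infinite sets of atoms only those that are determined by a finite set do.
\<close>
definition finite_sets :: "'v set set" where "finite_sets = {Y. Y \<subseteq> atoms \<and> finite Y}"

definition definable_sets :: "'v set set"
  where "definable_sets = {X. X \<subseteq> atoms \<and> (\<exists>E. E \<subseteq> atoms \<and> finite E \<and> determined E X)}"

definition sequences :: "'v list set" where "sequences = {xs. set xs \<subseteq> atoms}"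

definition injective_sequences :: "'v list set"
  where "injective_sequences = {xs. set xs \<subseteq> atoms \<and> distinct xs}"

lemma small_atom_set: "X \<subseteq> atoms \<Longrightarrow> small X"
  using small_subset small_atoms by blast

lemma inj_on_vset: "inj_on vset (Pow atoms)"
  using vset_eq_iff[OF small_atom_set small_atom_set] by (intro inj_onI) blast

lemma supports_set_iff:
  assumes "E \<subseteq> atoms" "finite E" "X \<subseteq> atoms"
  shows "supports G E (vset X) \<longleftrightarrow> determined E X"
proof -
  have "extend \<pi> (vset X) = vset X \<longleftrightarrow> \<pi> ` X = X" if "\<pi> \<in> G" for \<pi>
  proof -
    have "\<pi> ` X \<subseteq> atoms" using permutes_image[OF permutes_atoms[OF that]] assms(3) by blast
    then show ?thesis
      using extend_vset_atoms[OF permutes_atoms[OF that] assms(3)]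
        vset_eq_iff[OF small_atom_set small_atom_set] assms(3) by simp
  qed
  then show ?thesis
    unfolding determined_iff_invariant[OF assms(2,1,3)] supports_def fix_group_def by blast
qed

lemma supports_atom_iff:
  assumes "E \<subseteq> atoms" "finite E" "a \<in> atoms"
  shows "supports G E a \<longleftrightarrow> a \<in> E"
proof -
  have "supports G E a \<longleftrightarrow> supports G E (vset {a})"
    unfolding supports_def using assms(3) extend_vset[OF fix_group_permutes small_finite, of _ E "{a}"]
    by (auto simp: vset_eq_iff small_finite)
  also have "\<dots> \<longleftrightarrow> a \<in> E"
    using supports_set_iff[OF assms(1,2)] finite_determined_iff[OF assms(2,1)] assms(3) by simp
  finally show ?thesis .
qed

lemma supports_vseq_iff:
  assumes "E \<subseteq> atoms" "finite E" "set xs \<subseteq> atoms"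
  shows "supports G E (vseq xs) \<longleftrightarrow> set xs \<subseteq> E"
proof -
  have "extend \<pi> (vseq xs) = vseq xs \<longleftrightarrow> (\<forall>a\<in>set xs. extend \<pi> a = a)" if "\<pi> \<in> fix_group G E" for \<pi>
    by (simp add: extend_vseq[OF fix_group_permutes[OF that]] inj_eq[OF inj_vseq] map_eq_conv[of _ _ id, simplified])
  then have "supports G E (vseq xs) \<longleftrightarrow> (\<forall>a\<in>set xs. supports G E a)"
    unfolding supports_def by blast
  also have "\<dots> \<longleftrightarrow> set xs \<subseteq> E" using supports_atom_iff assms by blast
  finally show ?thesis .
qed

lemma set_in_model_iff: "X \<subseteq> atoms \<Longrightarrow> vset X \<in> M \<longleftrightarrow> X \<in> definable_sets"
  using in_permutation_model_iff[of "vset X" G] supports_set_iff[of _ X] atom_in_model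
  unfolding definable_sets_def by (auto simp: elts_vset small_atom_set)

lemma finite_set_definable: "finite_sets \<subseteq> definable_sets"
  unfolding finite_sets_def definable_sets_def using determined_subset by blast

lemma definable_set_in_model: "X \<in> definable_sets \<Longrightarrow> vset X \<in> M"
  using set_in_model_iff[of X] by (simp add: definable_sets_def)

lemma vseq_in_model: "set xs \<subseteq> atoms \<Longrightarrow> vseq xs \<in> M"
proof -
  assume xs: "set xs \<subseteq> atoms"
  then have "elts (vseq xs) \<subseteq> M"
    unfolding elts_vseq using vpair_in_model[OF vnat_in_model atom_in_model] by (auto simp: subset_iff)
  then show ?thesis using xs supports_vseq_iff[of "set xs" xs] in_permutation_model_iff[of "vseq xs" G] by auto
qed

lemma elts_vset_atoms: "elts (vset atoms :: 'v) = atoms"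
  using elts_vset small_atoms by blast

text \<open>
  An enumeration of a finite set of atoms is a finite sequence of atoms and so belongs to the model;
  therefore the model and the surrounding universe agree on which sets of atoms are finite.
\<close>
lemma fin_in_eq: "fin_in M (vset atoms) = vset (vset ` finite_sets)"
proof -
  have "y \<in> M \<and> \<not> is_atom y \<and> elts y \<subseteq> atoms \<and> (\<exists>n. \<exists>f\<in>M. vbijection f (vnat n) y)
      \<longleftrightarrow> y \<in> vset ` finite_sets" for y
  proof
    assume y: "y \<in> M \<and> \<not> is_atom y \<and> elts y \<subseteq> atoms \<and> (\<exists>n. \<exists>f\<in>M. vbijection f (vnat n) y)"
    then obtain n f where f: "vbijection f (vnat n) y" by blast
    then obtain xs where xs: "f = vseq xs"
      unfolding vbijection_def vinjection_vnat_iff by blast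
    have "elts y \<subseteq> set xs" using f unfolding vbijection_def xs by (auto simp: vpair_mem_vseq)
    then have "finite (elts y)" using finite_subset by blast
    then show "y \<in> vset ` finite_sets"
      using y vset_elts[of y] unfolding finite_sets_def by (metis (mono_tags, lifting) image_eqI mem_Collect_eq)
  next
    assume "y \<in> vset ` finite_sets"
    then obtain Y where Y: "Y \<subseteq> atoms" "finite Y" "y = vset Y" unfolding finite_sets_def by blast
    then obtain xs where xs: "set xs = Y" "distinct xs" using finite_distinct_list by blast
    have elts: "elts y = Y" using elts_vset small_atom_set Y by blast
    have "vbijection (vseq xs) (vnat (length xs)) y"
      unfolding vbijection_def vinjection_vnat_iff using xs elts by (auto simp: vpair_mem_vseq set_conv_nth)
    moreover have "vseq xs \<in> M" using vseq_in_model xs Y by blast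
    moreover have "y \<in> M"
      using definable_set_in_model[of Y] finite_set_definable Y unfolding finite_sets_def by blast
    moreover have "\<not> is_atom y" using not_is_atom_vset small_atom_set Y by blast
    ultimately show "y \<in> M \<and> \<not> is_atom y \<and> elts y \<subseteq> atoms \<and> (\<exists>n. \<exists>f\<in>M. vbijection f (vnat n) y)"
      using elts Y(1) by blast
  qed
  then show ?thesis unfolding fin_in_def elts_vset_atoms by (auto intro: arg_cong[where f = vset])
qed

lemma power_in_eq: "power_in M (vset atoms) = vset (vset ` definable_sets)"
proof -
  have "y \<in> M \<and> \<not> is_atom y \<and> elts y \<subseteq> atoms \<longleftrightarrow> y \<in> vset ` definable_sets" for y
  proof
    assume y: "y \<in> M \<and> \<not> is_atom y \<and> elts y \<subseteq> atoms"
    then have "vset (elts y) = y" using vset_elts by blast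
    then show "y \<in> vset ` definable_sets" using y set_in_model_iff[of "elts y"] by (metis image_eqI)
  next
    assume "y \<in> vset ` definable_sets"
    then obtain Y where Y: "Y \<in> definable_sets" "y = vset Y" by blast
    then have sub: "Y \<subseteq> atoms" unfolding definable_sets_def by blast
    then show "y \<in> M \<and> \<not> is_atom y \<and> elts y \<subseteq> atoms"
      using Y set_in_model_iff small_atom_set[OF sub] by (simp add: elts_vset not_is_atom_vset)
  qed
  then show ?thesis unfolding power_in_def elts_vset_atoms by (auto intro: arg_cong[where f = vset])
qed

lemma seq_in_eq: "seq_in M (vset atoms) = vset (vseq ` sequences)"
proof -
  have "{s \<in> M. \<exists>n. vfunction s (vnat n) (vset atoms)} = vseq ` sequences"
    unfolding vfunction_vnat_iff elts_vset_atoms sequences_def using vseq_in_model by blast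
  then show ?thesis unfolding seq_in_def by simp
qed

lemma seq_inj_in_eq: "seq_inj_in M (vset atoms) = vset (vseq ` injective_sequences)"
proof -
  have "{s \<in> M. \<exists>n. vinjection s (vnat n) (vset atoms)} = vseq ` injective_sequences"
    unfolding vinjection_vnat_iff elts_vset_atoms injective_sequences_def using vseq_in_model by blast
  then show ?thesis unfolding seq_inj_in_def by simp
qed

lemma finite_sets_image: "\<pi> \<in> G \<Longrightarrow> Y \<in> finite_sets \<Longrightarrow> \<pi> ` Y \<in> finite_sets"
  unfolding finite_sets_def using permutes_in_image[OF permutes_atoms] by auto

lemma definable_sets_image: "\<pi> \<in> G \<Longrightarrow> X \<in> definable_sets \<Longrightarrow> \<pi> ` X \<in> definable_sets"
proof -
  assume \<pi>: "\<pi> \<in> G" and "X \<in> definable_sets"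
  then obtain E where X: "X \<subseteq> atoms" "E \<subseteq> atoms" "finite E" "determined E X"
    unfolding definable_sets_def by blast
  have "\<pi> ` X \<subseteq> atoms" "\<pi> ` E \<subseteq> atoms" "finite (\<pi> ` E)"
    using X permutes_in_image[OF permutes_atoms[OF \<pi>]] by auto
  moreover have "determined (\<pi> ` E) (\<pi> ` X)" by (rule determined_image[OF \<pi> X(2,4)])
  ultimately show ?thesis unfolding definable_sets_def by blast
qed

lemma sequences_map: "\<pi> \<in> G \<Longrightarrow> xs \<in> sequences \<Longrightarrow> map \<pi> xs \<in> sequences"
  unfolding sequences_def using permutes_in_image[OF permutes_atoms] by auto

lemma injective_sequences_map: "\<pi> \<in> G \<Longrightarrow> xs \<in> injective_sequences \<Longrightarrow> map \<pi> xs \<in> injective_sequences"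
  unfolding injective_sequences_def using permutes_in_image[OF permutes_atoms]
  by (auto simp: distinct_map permutes_inj_on[OF permutes_atoms])

lemma invariant_set_in_model:
  assumes "small X" "X \<subseteq> M" "\<And>\<pi> x. \<pi> \<in> G \<Longrightarrow> x \<in> X \<Longrightarrow> extend \<pi> x \<in> X"
  shows "vset X \<in> M \<and> \<not> is_atom (vset X) \<and> supports G {} (vset X) \<and> elts (vset X) = X"
  using assms vset_in_model[of X "{}"] supports_vset[of X "{}"]
  by (auto simp: not_is_atom_vset elts_vset fix_group_def)

lemma set_of_atoms_in_model:
  "vset atoms \<in> M \<and> \<not> is_atom (vset atoms :: 'v) \<and> supports G {} (vset atoms) \<and> elts (vset atoms) = (atoms :: 'v set)"
  using small_atoms atom_in_model extend_atom[OF permutes_atoms] permutes_in_image[OF permutes_atoms]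
  by (intro invariant_set_in_model) auto

lemma set_of_finite_sets_in_model:
  "vset (vset ` finite_sets) \<in> M \<and> \<not> is_atom (vset (vset ` finite_sets)) \<and>
   supports G {} (vset (vset ` finite_sets)) \<and> elts (vset (vset ` finite_sets)) = vset ` finite_sets"
proof (rule invariant_set_in_model)
  show "small (vset ` finite_sets)"
    by (rule small_subset[OF small_Pow[OF small_atoms]]) (auto simp: finite_sets_def)
  show "vset ` finite_sets \<subseteq> M"
    using definable_set_in_model finite_set_definable by blast
  fix \<pi> x assume \<pi>: "\<pi> \<in> G" and "x \<in> vset ` finite_sets"
  then obtain Y where "Y \<in> finite_sets" "x = vset Y" by blast
  then show "extend \<pi> x \<in> vset ` finite_sets"
    using finite_sets_image[OF \<pi>] extend_vset_atoms[OF permutes_atoms[OF \<pi>], of Y] by (simp add: finite_sets_def)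
qed

lemma set_of_definable_sets_in_model:
  "vset (vset ` definable_sets) \<in> M \<and> \<not> is_atom (vset (vset ` definable_sets)) \<and>
   supports G {} (vset (vset ` definable_sets)) \<and> elts (vset (vset ` definable_sets)) = vset ` definable_sets"
proof (rule invariant_set_in_model)
  show "small (vset ` definable_sets)"
    by (rule small_subset[OF small_Pow[OF small_atoms]]) (auto simp: definable_sets_def)
  show "vset ` definable_sets \<subseteq> M"
    using definable_set_in_model by blast
  fix \<pi> x assume \<pi>: "\<pi> \<in> G" and "x \<in> vset ` definable_sets"
  then obtain Y where Y: "Y \<in> definable_sets" "x = vset Y" by blast
  then have "extend \<pi> x = vset (\<pi> ` Y)"
    using extend_vset_atoms[OF permutes_atoms[OF \<pi>], of Y] by (simp add: definable_sets_def)
  then show "extend \<pi> x \<in> vset ` definable_sets" using definable_sets_image[OF \<pi> Y(1)] by blast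
qed

lemma countable_sequences: "countable sequences"
  unfolding sequences_def lists_eq_set[symmetric] using countable_A by (rule countable_lists)

lemma set_of_sequences_in_model:
  "vset (vseq ` sequences) \<in> M \<and> \<not> is_atom (vset (vseq ` sequences)) \<and>
   supports G {} (vset (vseq ` sequences)) \<and> elts (vset (vseq ` sequences)) = vseq ` sequences"
proof (rule invariant_set_in_model)
  show "small (vseq ` sequences)" using countable_sequences by (intro small_countable) simp
  show "vseq ` sequences \<subseteq> M" using vseq_in_model unfolding sequences_def by blast
  fix \<pi> x assume \<pi>: "\<pi> \<in> G" and "x \<in> vseq ` sequences"
  then obtain xs where xs: "xs \<in> sequences" "x = vseq xs" by blast
  then have "extend \<pi> x = vseq (map \<pi> xs)"
    using extend_vseq_atoms[OF permutes_atoms[OF \<pi>], of xs] by (simp add: sequences_def)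
  then show "extend \<pi> x \<in> vseq ` sequences" using sequences_map[OF \<pi> xs(1)] by blast
qed

lemma set_of_injective_sequences_in_model:
  "vset (vseq ` injective_sequences) \<in> M \<and> \<not> is_atom (vset (vseq ` injective_sequences)) \<and>
   supports G {} (vset (vseq ` injective_sequences)) \<and>
   elts (vset (vseq ` injective_sequences)) = vseq ` injective_sequences"
proof (rule invariant_set_in_model)
  have "injective_sequences \<subseteq> sequences" unfolding sequences_def injective_sequences_def by blast
  then have "countable injective_sequences" using countable_sequences countable_subset by blast
  then show "small (vseq ` injective_sequences)" by (intro small_countable) simp
  show "vseq ` injective_sequences \<subseteq> M" using vseq_in_model unfolding injective_sequences_def by blast
  fix \<pi> x assume \<pi>: "\<pi> \<in> G" and "x \<in> vseq ` injective_sequences"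
  then obtain xs where xs: "xs \<in> injective_sequences" "x = vseq xs" by blast
  then have "extend \<pi> x = vseq (map \<pi> xs)"
    using extend_vseq_atoms[OF permutes_atoms[OF \<pi>], of xs] by (simp add: injective_sequences_def)
  then show "extend \<pi> x \<in> vseq ` injective_sequences" using injective_sequences_map[OF \<pi> xs(1)] by blast
qed

context
  fixes E :: "'v set" assumes E: "E \<subseteq> atoms" "finite E"
begin

text \<open>
  The next lemmas determine the elements with support \<open>E\<close> of each of the five sets, and count them.
\<close>
lemma supported_atoms: "{a\<in>atoms. supports G E a} = E"
  using supports_atom_iff[OF E] E(1) by blast

lemma supported_finite_sets: "{y\<in>vset ` finite_sets. supports G E y} = vset ` Pow E"
proof -
  have "supports G E (vset Y) \<longleftrightarrow> Y \<subseteq> E" if "Y \<in> finite_sets" for Y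
    using that supports_set_iff[OF E] finite_determined_iff[OF E(2,1)] unfolding finite_sets_def by blast
  moreover have "Pow E \<subseteq> finite_sets" unfolding finite_sets_def using E finite_subset by auto
  ultimately show ?thesis by blast
qed

lemma supported_definable_sets:
  "{y\<in>vset ` definable_sets. supports G E y} = vset ` {X. X \<subseteq> atoms \<and> determined E X}"
  using supports_set_iff[OF E] E unfolding definable_sets_def by blast

lemma supported_sequences: "{y\<in>vseq ` sequences. supports G E y} = vseq ` {xs. set xs \<subseteq> E}"
  using supports_vseq_iff[OF E] E(1) unfolding sequences_def by blast

lemma supported_injective_sequences:
  "{y\<in>vseq ` injective_sequences. supports G E y} = vseq ` {xs. set xs \<subseteq> E \<and> distinct xs}"
  using supports_vseq_iff[OF E] E(1) unfolding injective_sequences_def by blast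

lemma card_supported_finite_sets: "card (vset ` Pow E) = 2 ^ card E"
proof -
  have "inj_on vset (Pow E)" using inj_on_vset by (rule inj_on_subset) (use E in blast)
  then show ?thesis using E by (simp add: card_image card_Pow)
qed

lemma supported_definable_sets_bounds:
  "finite {X. X \<subseteq> atoms \<and> determined E X}"
  "2 ^ card E < card (vset ` {X. X \<subseteq> atoms \<and> determined E X})"
  "card (vset ` {X. X \<subseteq> atoms \<and> determined E X}) \<le> 2 ^ (2 * card E + 1)"
proof -
  let ?D = "{X. X \<subseteq> atoms \<and> determined E X}"
  show fin: "finite ?D" by (rule card_determined_le[OF E(2,1)])
  have "inj_on vset ?D" using inj_on_vset by (rule inj_on_subset) blast
  then have card: "card (vset ` ?D) = card ?D" by (rule card_image)
  then show "card (vset ` ?D) \<le> 2 ^ (2 * card E + 1)" using card_determined_le[OF E(2,1)] by simp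
  have "atoms \<notin> Pow E" using E infinite_A finite_subset by blast
  moreover have "insert atoms (Pow E) \<subseteq> ?D" using E determined_subset by (auto simp: determined_def)
  ultimately have "Suc (2 ^ card E) \<le> card ?D"
    using card_mono[OF fin, of "insert atoms (Pow E)"] E(2) by (simp add: card_Pow)
  then show "2 ^ card E < card (vset ` ?D)" using card by simp
qed

lemma fact_le_card_supported_injective_sequences:
  "finite {xs. set xs \<subseteq> E \<and> distinct xs}" "fact (card E) \<le> card (vseq ` {xs. set xs \<subseteq> E \<and> distinct xs})"
proof -
  show fin: "finite {xs. set xs \<subseteq> E \<and> distinct xs}" using E(2) by (rule finite_subset_distinct)
  have "permutations_of_set E \<subseteq> {xs. set xs \<subseteq> E \<and> distinct xs}" by (auto dest: permutations_of_setD)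
  then have "card (permutations_of_set E) \<le> card {xs. set xs \<subseteq> E \<and> distinct xs}" by (rule card_mono[OF fin])
  moreover have "inj_on vseq {xs. set xs \<subseteq> E \<and> distinct xs}" using inj_vseq by (rule inj_on_subset) simp
  ultimately show "fact (card E) \<le> card (vseq ` {xs. set xs \<subseteq> E \<and> distinct xs})"
    using E(2) by (simp add: card_image)
qed

end

section \<open>The four inequalities\<close>

lemma ex_ten_atoms: "\<exists>P :: 'v set. P \<subseteq> atoms \<and> finite P \<and> card P = 10"
  using infinite_arbitrarily_large[OF infinite_A, of 10] by metis

text \<open>
  The two counts are \<open>card E\<close> and \<open>2 ^ card E\<close>.
\<close>
lemma atoms_less_fin:
  "cardinal_less M (cardinality M (vset atoms)) (cardinality M (fin_in M (vset atoms)))"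
  unfolding cardinal_less_def fin_in_eq
proof
  show "cardinal_le M (cardinality M (vset atoms)) (cardinality M (vset (vset ` finite_sets)))"
  proof (rule cardinal_leI[where E = "{}" and h = "\<lambda>a. vset {a}"])
    show "inj_on (\<lambda>a. vset {a}) (elts (vset atoms))"
      by (intro inj_onI) (simp add: vset_eq_iff small_finite)
    fix \<pi> and a :: 'v assume "\<pi> \<in> fix_group G {}"
    then show "vset {extend \<pi> a} = extend \<pi> (vset {a})"
      using extend_vset[OF fix_group_permutes small_finite, of \<pi> "{}" "{a}"] by simp
  qed (use set_of_atoms_in_model set_of_finite_sets_in_model in \<open>auto simp: finite_sets_def\<close>)
  show "cardinality M (vset atoms) \<noteq> cardinality M (vset (vset ` finite_sets))"
  proof (rule cardinality_neqI[where ?E0.0 = "{}"])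
    fix E :: "'v set" assume E: "E \<subseteq> atoms" "finite E"
    have "card E < 2 ^ card E" by simp
    then show "\<nexists>g. bij_betw g {a \<in> elts (vset atoms). supports G E a}
        {b \<in> elts (vset (vset ` finite_sets)). supports G E b}"
      by (simp only: set_of_atoms_in_model set_of_finite_sets_in_model supported_atoms[OF E] supported_finite_sets[OF E])
        (metis bij_betw_same_card card_supported_finite_sets[OF E] less_irrefl_nat)
  qed (use set_of_finite_sets_in_model in auto)
qed

text \<open>
  A finite set with support \<open>E\<close> is a subset of \<open>E\<close>, but the set of all atoms also has support \<open>E\<close>.
\<close>
lemma fin_less_power:
  "cardinal_less M (cardinality M (fin_in M (vset atoms))) (cardinality M (power_in M (vset atoms)))"
  unfolding cardinal_less_def fin_in_eq power_in_eq
proof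
  show "cardinal_le M (cardinality M (vset (vset ` finite_sets))) (cardinality M (vset (vset ` definable_sets)))"
    by (rule cardinal_leI[where E = "{}" and h = "\<lambda>a. a"])
      (use set_of_finite_sets_in_model set_of_definable_sets_in_model finite_set_definable in auto)
  show "cardinality M (vset (vset ` finite_sets)) \<noteq> cardinality M (vset (vset ` definable_sets))"
  proof (rule cardinality_neqI[where ?E0.0 = "{}"])
    fix E :: "'v set" assume E: "E \<subseteq> atoms" "finite E"
    show "\<nexists>g. bij_betw g {a \<in> elts (vset (vset ` finite_sets)). supports G E a}
        {b \<in> elts (vset (vset ` definable_sets)). supports G E b}"
      by (simp only: set_of_finite_sets_in_model set_of_definable_sets_in_model supported_finite_sets[OF E] supported_definable_sets[OF E])
        (metis bij_betw_same_card card_supported_finite_sets[OF E]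
          supported_definable_sets_bounds(2)[OF E] less_irrefl_nat)
  qed (use set_of_definable_sets_in_model in auto)
qed

text \<open>
  The injection is \<open>encode\<close> with ten parameters, which form its support. For the strictness, a set
  \<open>E\<close> with at least ten elements has more permutations than there are sets with support \<open>E\<close>.
\<close>
lemma power_less_seq_inj:
  "cardinal_less M (cardinality M (power_in M (vset atoms))) (cardinality M (seq_inj_in M (vset atoms)))"
  unfolding cardinal_less_def seq_inj_in_eq power_in_eq
proof
  obtain P :: "'v set" where P: "P \<subseteq> atoms" "finite P" "card P = 10" using ex_ten_atoms by blast
  then have P': "finite P" "P \<subseteq> atoms" "10 \<le> card P" by auto
  show "cardinal_le M (cardinality M (vset (vset ` definable_sets)))
      (cardinality M (vset (vseq ` injective_sequences)))"
  proof (rule cardinal_leI[where E = P and h = "\<lambda>x. vseq (encode P (elts x))"])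
    have code: "encode P X \<in> injective_sequences" if "X \<in> definable_sets" for X
    proof -
      from that obtain E where "finite E" "E \<subseteq> atoms" "determined E X"
        unfolding definable_sets_def by blast
      from encode_permutation(1,2)[OF P' this] show ?thesis
        using P(1) bd_subset_A by (simp add: injective_sequences_def)
    qed
    have elts: "elts (vset X) = X" if "X \<in> definable_sets" for X
      using that elts_vset small_atom_set unfolding definable_sets_def by blast
    show "(\<lambda>x. vseq (encode P (elts x))) ` elts (vset (vset ` definable_sets))
        \<subseteq> elts (vset (vseq ` injective_sequences))"
      using set_of_definable_sets_in_model set_of_injective_sequences_in_model code elts by auto
    show "inj_on (\<lambda>x. vseq (encode P (elts x))) (elts (vset (vset ` definable_sets)))"
    proof (rule inj_onI)
      fix x y assume "x \<in> elts (vset (vset ` definable_sets))" "y \<in> elts (vset (vset ` definable_sets))"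
        and eq: "vseq (encode P (elts x)) = vseq (encode P (elts y))"
      then obtain X Y where X: "X \<in> definable_sets" "x = vset X" and Y: "Y \<in> definable_sets" "y = vset Y"
        using set_of_definable_sets_in_model by auto
      have "encode P X = encode P Y" using eq elts X Y by (simp add: inj_eq[OF inj_vseq])
      then have "X = Y" using encode_inj[OF P'] X(1) Y(1) unfolding definable_sets_def by blast
      then show "x = y" using X Y by simp
    qed
    fix \<pi> x assume \<pi>: "\<pi> \<in> fix_group G P" and "x \<in> elts (vset (vset ` definable_sets))"
    then obtain X where X: "X \<in> definable_sets" "x = vset X" using set_of_definable_sets_in_model by auto
    then obtain E where E: "finite E" "E \<subseteq> atoms" "determined E X" "X \<subseteq> atoms"
      unfolding definable_sets_def by blast
    have \<pi>': "\<pi> \<in> G" "\<And>p. p \<in> P \<Longrightarrow> \<pi> p = p" using \<pi> unfolding fix_group_def by auto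
    note perm = permutes_atoms[OF \<pi>'(1)]
    have "elts (extend \<pi> x) = \<pi> ` X"
      using extend_vset_atoms[OF perm E(4)] definable_sets_image[OF \<pi>'(1) X(1)] elts X(2) by simp
    then have "vseq (encode P (elts (extend \<pi> x))) = vseq (map \<pi> (encode P X))"
      using encode_equivariant[OF \<pi>'(1) P' \<pi>'(2) E] by simp
    also have "\<dots> = extend \<pi> (vseq (encode P X))"
      using extend_vseq_atoms[OF perm, of "encode P X"] code[OF X(1)] by (simp add: injective_sequences_def)
    finally show "vseq (encode P (elts (extend \<pi> x))) = extend \<pi> (vseq (encode P (elts x)))"
      using elts X by simp
  qed (use set_of_definable_sets_in_model set_of_injective_sequences_in_model P
      supports_mono[of G "{}" "vset (vset ` definable_sets)" P] in auto)
  show "cardinality M (vset (vset ` definable_sets)) \<noteq> cardinality M (vset (vseq ` injective_sequences))"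
  proof (rule cardinality_neqI[where ?E0.0 = P])
    fix E :: "'v set" assume E: "P \<subseteq> E" "E \<subseteq> atoms" "finite E"
    have "10 \<le> card E" using P(3) card_mono[OF E(3,1)] by simp
    then have "card (vset ` {X. X \<subseteq> atoms \<and> determined E X}) < card (vseq ` {xs. set xs \<subseteq> E \<and> distinct xs})"
      using supported_definable_sets_bounds(3)[OF E(2,3)] pow_less_fact[of "card E"]
        fact_le_card_supported_injective_sequences(2)[OF E(2,3)] by linarith
    then have "\<not> bij_betw g (vset ` {X. X \<subseteq> atoms \<and> determined E X})
        (vseq ` {xs. set xs \<subseteq> E \<and> distinct xs})" for g
      using bij_betw_same_card[of g] by force
    then show "\<nexists>g. bij_betw g {a \<in> elts (vset (vset ` definable_sets)). supports G E a}
        {b \<in> elts (vset (vseq ` injective_sequences)). supports G E b}"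
      by (simp only: set_of_definable_sets_in_model set_of_injective_sequences_in_model supported_definable_sets[OF E(2,3)]
          supported_injective_sequences[OF E(2,3)]) simp
  qed (use set_of_injective_sequences_in_model P in auto)
qed

text \<open>
  Over a nonempty finite set \<open>E\<close> there are infinitely many sequences, but only finitely many without
  repetition.
\<close>
lemma seq_inj_less_seq:
  "cardinal_less M (cardinality M (seq_inj_in M (vset atoms))) (cardinality M (seq_in M (vset atoms)))"
  unfolding cardinal_less_def seq_inj_in_eq seq_in_eq
proof
  show "cardinal_le M (cardinality M (vset (vseq ` injective_sequences))) (cardinality M (vset (vseq ` sequences)))"
    by (rule cardinal_leI[where E = "{}" and h = "\<lambda>a. a"])
      (use set_of_sequences_in_model set_of_injective_sequences_in_model in \<open>auto simp: sequences_def injective_sequences_def\<close>)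
  obtain a :: 'v where a: "a \<in> atoms" using infinite_A by (metis ex_in_conv finite.emptyI)
  show "cardinality M (vset (vseq ` injective_sequences)) \<noteq> cardinality M (vset (vseq ` sequences))"
  proof (rule cardinality_neqI[where ?E0.0 = "{a}"])
    fix E :: "'v set" assume E: "{a} \<subseteq> E" "E \<subseteq> atoms" "finite E"
    have "inj (\<lambda>n. replicate n a)" by (rule injI) (metis length_replicate)
    then have "infinite (range (\<lambda>n. replicate n a))" using finite_imageD by blast
    moreover have "range (\<lambda>n. replicate n a) \<subseteq> {xs. set xs \<subseteq> E}" using E(1) by (auto split: if_splits)
    ultimately have "infinite {xs. set xs \<subseteq> E}" using finite_subset by blast
    then have "infinite (vseq ` {xs. set xs \<subseteq> E})"
      using finite_imageD[OF _ inj_on_subset[OF inj_vseq]] by blast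
    moreover have "finite (vseq ` {xs. set xs \<subseteq> E \<and> distinct xs})"
      using fact_le_card_supported_injective_sequences(1)[OF E(2,3)] by blast
    ultimately have "\<not> bij_betw g (vseq ` {xs. set xs \<subseteq> E \<and> distinct xs}) (vseq ` {xs. set xs \<subseteq> E})" for g
      using bij_betw_finite[of g] by blast
    then show "\<nexists>g. bij_betw g {b \<in> elts (vset (vseq ` injective_sequences)). supports G E b}
        {b \<in> elts (vset (vseq ` sequences)). supports G E b}"
      by (simp only: set_of_injective_sequences_in_model set_of_sequences_in_model supported_injective_sequences[OF E(2,3)]
          supported_sequences[OF E(2,3)]) simp
  qed (use set_of_sequences_in_model a in auto)
qed

end

theorem proposition7p2p3:
  fixes R :: "('v::zfa_choice \<times> 'v) set" and V\<^sub>M :: "'v set" and m :: 'v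
  assumes "countable (atoms :: 'v set)" and "infinite (atoms :: 'v set)"
    and "dense_order_without_endpoints (atoms :: 'v set) R"
    and "V\<^sub>M = mostowski_model R" and "m = vset atoms"
  shows "cardinal_less V\<^sub>M (cardinality V\<^sub>M m) (cardinality V\<^sub>M (fin_in V\<^sub>M m)) \<and>
         cardinal_less V\<^sub>M (cardinality V\<^sub>M (fin_in V\<^sub>M m)) (cardinality V\<^sub>M (power_in V\<^sub>M m)) \<and>
         cardinal_less V\<^sub>M (cardinality V\<^sub>M (power_in V\<^sub>M m)) (cardinality V\<^sub>M (seq_inj_in V\<^sub>M m)) \<and>
         cardinal_less V\<^sub>M (cardinality V\<^sub>M (seq_inj_in V\<^sub>M m)) (cardinality V\<^sub>M (seq_in V\<^sub>M m))"
proof -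
  interpret mostowski R by unfold_locales (fact assms)+
  show ?thesis
    unfolding assms(4,5) mostowski_model_def
    using atoms_less_fin fin_less_power power_less_seq_inj seq_inj_less_seq by blast
qed

end
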